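(* Let $G$ be a graph, let $\pi=(V_1,\ldots,V_m)$ be an arbitrary clique partition of $G$ (into $m$ parts), and let $r_1,\ldots,r_m$ be positive integers. Then all powers of the vertex cover ideal $I_{G^{\pi}(r_1,\ldots,r_m)}$ of the clique multi-whiskered graph $G^{\pi}(r_1,\ldots,r_m)$ have linear quotients and hence are componentwise linear.
   Context: Graphs are finite and simple. Let $G$ be a graph on $V(G)=\{x_1,\ldots,x_n\}$. A clique partition $\pi$ of $G$ is a partition of $V(G)$ into disjoint subsets $V_1,\ldots,V_m$ such that for each $1\le i\le m$ the induced subgraph of $G$ on $V_i$ is a complete graph. For a clique partition $\pi=(V_1,\ldots,V_m)$ and positive integers $r_1,\ldots,r_m$, the clique multi-whiskered graph $G^{\pi}(r_1,\ldots,r_m)$ has vertex set $V(G)\cup\bigcup_{i=1}^m\{z_1^{(i)},\ldots,z_{r_i}^{(i)}\}$ (the $z_k^{(i)}$ being new, pairwise distinct vertices) and edge set $$E(G)\cup\bigcup_{i=1}^m\bigcup_{x_j\in V_i}\{\{x_j,z_1^{(i)}\},\{x_j,z_2^{(i)}\},\ldots,\{x_j,z_{r_i}^{(i)}\}\}.$$ Let $S$ be the polynomial ring over a field $K$ whose variables are the vertices of $G^{\pi}(r_1,\ldots,r_m)$. A vertex cover of a graph is a set of vertices meeting every edge; it is minimal if no proper subset is a vertex cover. The vertex cover ideal of $G^{\pi}(r_1,\ldots,r_m)$ is the squarefree monomial ideal $I_{G^{\pi}(r_1,\ldots,r_m)}\subset S$ generated by the monomials $\prod_{w\in C}w$, where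 $C$ ranges over the minimal vertex covers of $G^{\pi}(r_1,\ldots,r_m)$. A monomial ideal $I$ has linear quotients if its minimal monomial generators can be ordered as $h_1,\ldots,h_s$ such that for every $2\le i\le s$ the colon ideal $(h_1,\ldots,h_{i-1}):h_i$ is generated by a subset of the variables. A graded ideal $I\subset S$ is componentwise linear if for every $j$ the ideal generated by all homogeneous elements of degree $j$ in $I$ has a linear resolution. *)

theory Defs
  imports
    "HOL-Library.Poly_Mapping"
    "HOL-Library.Disjoint_Sets"
    "HOL-Algebra.Ideal_Product"
    "Jordan_Normal_Form.Matrix"
begin

section \<open>Graphs, clique partitions and multi-whiskering\<close>

record 'v sgraph =
  verts :: "'v set"
  edges :: "'v set set"

definition simple_graph :: "'v sgraph \<Rightarrow> bool" where
  "simple_graph G \<longleftrightarrow>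
     finite (verts G) \<and> (\<forall>e\<in>edges G. e \<subseteq> verts G \<and> card e = 2)"

definition induced_subgraph :: "'v sgraph \<Rightarrow> 'v set \<Rightarrow> 'v sgraph" where
  "induced_subgraph G W = \<lparr>verts = W, edges = {e \<in> edges G. e \<subseteq> W}\<rparr>"

definition complete_graph :: "'v sgraph \<Rightarrow> bool" where
  "complete_graph G \<longleftrightarrow> (\<forall>x\<in>verts G. \<forall>y\<in>verts G. x \<noteq> y \<longrightarrow> {x, y} \<in> edges G)"

text \<open>The parts are \<open>P 1, \<dots>, P m\<close>. Empty parts are not excluded; such a part contributes
  only isolated vertices to the whiskered graph.\<close>

definition clique_partition :: "'v sgraph \<Rightarrow> nat \<Rightarrow> (nat \<Rightarrow> 'v set) \<Rightarrow> bool" where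
  "clique_partition G m P \<longleftrightarrow>
     (\<Union>i\<in>{1..m}. P i) = verts G \<and> disjoint_family_on P {1..m} \<and>
     (\<forall>i\<in>{1..m}. complete_graph (induced_subgraph G (P i)))"

text \<open>\<open>Whisker i k\<close> is the new vertex $z_k^{(i)}$.\<close>

datatype 'v wvertex = Base 'v | Whisker nat nat

definition multi_whiskered ::
    "'v sgraph \<Rightarrow> nat \<Rightarrow> (nat \<Rightarrow> 'v set) \<Rightarrow> (nat \<Rightarrow> nat) \<Rightarrow> 'v wvertex sgraph" where
  "multi_whiskered G m P r =
     \<lparr>verts = Base ` verts G \<union> (\<Union>i\<in>{1..m}. {Whisker i k | k. k \<in> {1..r i}}),
      edges = (\<lambda>e. Base ` e) ` edges G \<union>
        (\<Union>i\<in>{1..m}. \<Union>x\<in>P i. {{Base x, Whisker i k} | k. k \<in> {1..r i}})\<rparr>"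

definition vertex_cover :: "'v sgraph \<Rightarrow> 'v set \<Rightarrow> bool" where
  "vertex_cover G C \<longleftrightarrow> C \<subseteq> verts G \<and> (\<forall>e\<in>edges G. C \<inter> e \<noteq> {})"

definition minimal_vertex_cover :: "'v sgraph \<Rightarrow> 'v set \<Rightarrow> bool" where
  "minimal_vertex_cover G C \<longleftrightarrow> vertex_cover G C \<and> (\<forall>D. D \<subset> C \<longrightarrow> \<not> vertex_cover G D)"


section \<open>Polynomial rings and their ideals\<close>

text \<open>An exponent vector is a finitely supported map from variables to \<open>nat\<close>, a polynomial a
  finitely supported map from exponent vectors to coefficients. The type admits every element of
  \<open>'x\<close> as a variable; \<open>poly_ring X\<close> is the polynomial ring in the variables from \<open>X\<close> only, and all
  ideals below are ideals of this ring.\<close>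

type_synonym ('x, 'k) mpoly = "('x \<Rightarrow>\<^sub>0 nat) \<Rightarrow>\<^sub>0 'k"

definition poly_ring :: "'x set \<Rightarrow> ('x, 'k::field) mpoly ring" where
  "poly_ring X = \<lparr>carrier = {p. \<forall>u\<in>Poly_Mapping.keys p. Poly_Mapping.keys u \<subseteq> X},
     monoid.mult = (*), one = 1, zero = 0, add = (+)\<rparr>"

definition mono :: "('x \<Rightarrow>\<^sub>0 nat) \<Rightarrow> ('x, 'k::field) mpoly" where
  "mono u = Poly_Mapping.single u 1"

definition var :: "'x \<Rightarrow> ('x, 'k::field) mpoly" where
  "var x = mono (Poly_Mapping.single x 1)"

definition monomials :: "'x set \<Rightarrow> ('x, 'k::field) mpoly set" where
  "monomials X = {mono u | u. Poly_Mapping.keys u \<subseteq> X}"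

definition mdeg :: "('x \<Rightarrow>\<^sub>0 nat) \<Rightarrow> nat" where
  "mdeg u = (\<Sum>x\<in>Poly_Mapping.keys u. Poly_Mapping.lookup u x)"

definition homogeneous :: "nat \<Rightarrow> ('x, 'k::field) mpoly \<Rightarrow> bool" where
  "homogeneous j p \<longleftrightarrow> (\<forall>u\<in>Poly_Mapping.keys p. mdeg u = j)"

definition cover_ideal :: "'x sgraph \<Rightarrow> ('x, 'k::field) mpoly set" where
  "cover_ideal G =
     Idl\<^bsub>poly_ring (verts G)\<^esub> {\<Prod>w\<in>C. var w | C. minimal_vertex_cover G C}"

definition colon_ideal :: "('a, 'b) ring_scheme \<Rightarrow> 'a set \<Rightarrow> 'a \<Rightarrow> 'a set" where
  "colon_ideal R I h = {f \<in> carrier R. f \<otimes>\<^bsub>R\<^esub> h \<in> I}"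


section \<open>Linear quotients\<close>

text \<open>\<open>A\<close> is a minimal set of monomial generators of \<open>I\<close>; in particular \<open>I\<close> is then a monomial
  ideal.\<close>

definition minimal_monomial_gens ::
    "'x set \<Rightarrow> ('x, 'k::field) mpoly set \<Rightarrow> ('x, 'k) mpoly set \<Rightarrow> bool" where
  "minimal_monomial_gens X I A \<longleftrightarrow>
     A \<subseteq> monomials X \<and> Idl\<^bsub>poly_ring X\<^esub> A = I \<and>
     (\<forall>B. B \<subset> A \<longrightarrow> Idl\<^bsub>poly_ring X\<^esub> B \<noteq> I)"

text \<open>With lists indexed from 0, \<open>take i hs\<close> consists of the generators preceding \<open>hs ! i\<close>.\<close>

definition linear_quotients :: "'x set \<Rightarrow> ('x, 'k::field) mpoly set \<Rightarrow> bool" where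
  "linear_quotients X I \<longleftrightarrow>
     (\<exists>hs. distinct hs \<and> minimal_monomial_gens X I (set hs) \<and>
       (\<forall>i. 1 \<le> i \<and> i < length hs \<longrightarrow>
         (\<exists>Y\<subseteq>X. colon_ideal (poly_ring X) (Idl\<^bsub>poly_ring X\<^esub> (set (take i hs))) (hs ! i)
                = Idl\<^bsub>poly_ring X\<^esub> (var ` Y))))"


section \<open>Linear resolutions and componentwise linear ideals\<close>

definition free_module :: "'x set \<Rightarrow> nat \<Rightarrow> ('x, 'k::field) mpoly vec set" where
  "free_module X n = {v \<in> carrier_vec n. \<forall>l<n. v $ l \<in> carrier (poly_ring X)}"

text \<open>\<open>graded_hom X a b A\<close>: the matrix \<open>A\<close> represents a homogeneous homomorphism of degree 0 from
  the sum of the \<open>S(-b ! l)\<close> to the sum of the \<open>S(-a ! k)\<close>, with \<open>S = poly_ring X\<close>. So entry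
  \<open>(k, l)\<close> is homogeneous of degree \<open>b ! l - a ! k\<close>, and is 0 if this is negative.\<close>

definition graded_hom ::
    "'x set \<Rightarrow> nat list \<Rightarrow> nat list \<Rightarrow> ('x, 'k::field) mpoly mat \<Rightarrow> bool" where
  "graded_hom X a b A \<longleftrightarrow>
     A \<in> carrier_mat (length a) (length b) \<and>
     (\<forall>k<length a. \<forall>l<length b. A $$ (k, l) \<in> carrier (poly_ring X) \<and>
        (\<forall>u\<in>Poly_Mapping.keys (A $$ (k, l)). a ! k + mdeg u = b ! l))"

text \<open>A graded free resolution of an ideal \<open>J\<close>: the free module in homological degree \<open>i\<close> is the
  sum of the \<open>S(-e)\<close> for \<open>e\<close> in \<open>sh i\<close>, the matrix \<open>D 0\<close> (a single row) is the augmentation onto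
  \<open>J\<close>, and \<open>D (Suc i)\<close> is the differential from homological degree \<open>Suc i\<close> to \<open>i\<close>.\<close>

definition graded_free_resolution ::
    "'x set \<Rightarrow> ('x, 'k::field) mpoly set \<Rightarrow> (nat \<Rightarrow> nat list) \<Rightarrow>
     (nat \<Rightarrow> ('x, 'k) mpoly mat) \<Rightarrow> bool" where
  "graded_free_resolution X J sh D \<longleftrightarrow>
     graded_hom X [0] (sh 0) (D 0) \<and>
     (\<forall>i. graded_hom X (sh i) (sh (Suc i)) (D (Suc i))) \<and>
     {(D 0 *\<^sub>v v) $ 0 | v. v \<in> free_module X (length (sh 0))} = J \<and>
     (\<forall>i. {D (Suc i) *\<^sub>v v | v. v \<in> free_module X (length (sh (Suc i)))}
        = {v \<in> free_module X (length (sh i)). D i *\<^sub>v v = 0\<^sub>v (dim_row (D i))})"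

text \<open>Minimality: no entry of a differential has a constant term, i.e. the image of \<open>D (Suc i)\<close>
  lies in the product of the graded maximal ideal with the free module in degree \<open>i\<close>.\<close>

definition minimal_graded_free_resolution ::
    "'x set \<Rightarrow> ('x, 'k::field) mpoly set \<Rightarrow> (nat \<Rightarrow> nat list) \<Rightarrow>
     (nat \<Rightarrow> ('x, 'k) mpoly mat) \<Rightarrow> bool" where
  "minimal_graded_free_resolution X J sh D \<longleftrightarrow>
     graded_free_resolution X J sh D \<and>
     (\<forall>i. \<forall>k<length (sh i). \<forall>l<length (sh (Suc i)).
        Poly_Mapping.lookup (D (Suc i) $$ (k, l)) 0 = 0)"

text \<open>For some \<open>q\<close> the minimal resolution has the shape
  $\cdots \to S(-q-2)^{b_2} \to S(-q-1)^{b_1} \to S(-q)^{b_0} \to J \to 0$.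
  The zero ideal has a linear resolution, with all \<open>sh i\<close> empty.\<close>

definition linear_resolution :: "'x set \<Rightarrow> ('x, 'k::field) mpoly set \<Rightarrow> bool" where
  "linear_resolution X J \<longleftrightarrow>
     (\<exists>q sh D. minimal_graded_free_resolution X J sh D \<and> (\<forall>i. \<forall>e\<in>set (sh i). e = q + i))"

definition graded_ideal :: "'x set \<Rightarrow> ('x, 'k::field) mpoly set \<Rightarrow> bool" where
  "graded_ideal X I \<longleftrightarrow>
     ideal I (poly_ring X) \<and> I = Idl\<^bsub>poly_ring X\<^esub> {p \<in> I. \<exists>j. homogeneous j p}"

definition componentwise_linear :: "'x set \<Rightarrow> ('x, 'k::field) mpoly set \<Rightarrow> bool" where
  "componentwise_linear X I \<longleftrightarrow>
     graded_ideal X I \<and>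
     (\<forall>j. linear_resolution X (Idl\<^bsub>poly_ring X\<^esub> {p \<in> I. homogeneous j p}))"

end

theory Submission
  imports Defs "HOL-Library.List_Lexorder"
begin

text \<open>Minimal vertex covers of the whiskered graph correspond to independent sets of \<open>G\<close>, so the
  generators of the \<open>t\<close>-th power correspond to the sums \<open>a\<close> of \<open>t\<close> indicator functions of independent
  sets: the exponent is \<open>t - a x\<close> at a base vertex \<open>x\<close> and the sum of \<open>a\<close> over the part at a whisker.
  These \<open>a\<close> form a down-closed set. Ordering them by total size, the colon ideals are generated by the
  support of \<open>a\<close>, since lowering \<open>a\<close> at \<open>x\<close> gives an earlier generator dividing \<open>x\<close> times the
  one of \<open>a\<close>. The monomials of a fixed degree in the power are ordered similarly, with ties broken
  lexicographically, and again have linear quotients.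

  A module generated in one degree with linear quotients has a syzygy module that is generated by
  linear syzygies and again has linear quotients; iterating this gives the linear resolution, without
  Koszul complexes or mapping cones.\<close>

section \<open>The polynomial ring\<close>

text \<open>The cliques make the description additive: an independent set meets a clique in at most
  one vertex, so whether a whisker lies in a minimal cover is a sum of indicators, and products of
  covers become sums of functions. Positivity of the \<open>r i\<close> gives every base vertex an
  adjacent whisker; this makes the generators of a power incomparable and, in a fixed degree,
  supplies the variable that is lowered when a base exponent is raised.

  Componentwise linearity is not deduced from the linear quotients of the power: its generators may
  have different degrees, whereas the resolution constructed here is for generators of one degree.
  Each graded component is therefore ordered anew. Whether a monomial \<open>v\<close> belongs to it
  is tested on one candidate only, the pointwise least \<open>a\<close> whose base part divides
  \<open>v\<close>; down-closure is what allows this choice.\<close>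

lemma poly_ring_simps [simp]:
  "p \<otimes>\<^bsub>poly_ring X\<^esub> q = p * q" "p \<oplus>\<^bsub>poly_ring X\<^esub> q = p + q"
  "\<one>\<^bsub>poly_ring X\<^esub> = 1" "\<zero>\<^bsub>poly_ring X\<^esub> = 0"
  by (simp_all add: poly_ring_def)

abbreviation pcarrier :: "'x set \<Rightarrow> ('x, 'k::field) mpoly set" where
  "pcarrier X \<equiv> carrier (poly_ring X)"

lemma pcarrier_iff: "p \<in> pcarrier X \<longleftrightarrow> (\<forall>u\<in>Poly_Mapping.keys p. Poly_Mapping.keys u \<subseteq> X)"
  by (simp add: poly_ring_def)

lemma keys_uminus_eq: "Poly_Mapping.keys (- p) = Poly_Mapping.keys (p :: 'a \<Rightarrow>\<^sub>0 'b::ab_group_add)"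
  by (auto simp: in_keys_iff)

lemma keys_minus_subset:
  "Poly_Mapping.keys (p - q) \<subseteq> Poly_Mapping.keys p \<union> Poly_Mapping.keys (q :: 'a \<Rightarrow>\<^sub>0 'b::ab_group_add)"
  by (auto simp: in_keys_iff lookup_minus)

lemma keys_add_nat: "Poly_Mapping.keys (u + v :: 'x \<Rightarrow>\<^sub>0 nat) = Poly_Mapping.keys u \<union> Poly_Mapping.keys v"
  by (auto simp: in_keys_iff lookup_add)

lemma pcarrier_zero: "0 \<in> pcarrier X"
  by (simp add: pcarrier_iff)

lemma pcarrier_one: "1 \<in> pcarrier X"
  by (simp add: pcarrier_iff)

lemma pcarrier_add: "p \<in> pcarrier X \<Longrightarrow> q \<in> pcarrier X \<Longrightarrow> p + q \<in> pcarrier X"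
  using keys_add[of p q] by (fastforce simp: pcarrier_iff)

lemma pcarrier_uminus: "p \<in> pcarrier X \<Longrightarrow> - p \<in> pcarrier X"
  by (simp add: keys_uminus_eq pcarrier_iff)

lemma pcarrier_minus: "p \<in> pcarrier X \<Longrightarrow> q \<in> pcarrier X \<Longrightarrow> p - q \<in> pcarrier X"
  using keys_minus_subset[of p q] by (fastforce simp: pcarrier_iff)

lemma pcarrier_mult: "p \<in> pcarrier X \<Longrightarrow> q \<in> pcarrier X \<Longrightarrow> p * q \<in> pcarrier X"
  using keys_mult[of p q] by (fastforce simp: pcarrier_iff keys_add_nat)

lemma pcarrier_sum: "(\<And>i. i \<in> A \<Longrightarrow> f i \<in> pcarrier X) \<Longrightarrow> sum f A \<in> pcarrier X"
  by (induction A rule: infinite_finite_induct)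
     (simp_all add: pcarrier_zero pcarrier_add)

lemma pcarrier_mono: "Poly_Mapping.keys u \<subseteq> X \<Longrightarrow> mono u \<in> pcarrier X"
  by (simp add: mono_def pcarrier_iff)

lemma pcarrier_var: "x \<in> X \<Longrightarrow> var x \<in> pcarrier X"
  by (simp add: var_def mono_def pcarrier_iff)

lemmas pcarrier_intros = pcarrier_zero pcarrier_one pcarrier_add pcarrier_uminus pcarrier_minus
  pcarrier_mult pcarrier_sum pcarrier_mono pcarrier_var

lemma cring_poly_ring: "cring (poly_ring X :: ('x, 'k::field) mpoly ring)"
proof (rule cringI)
  show "abelian_group (poly_ring X :: ('x, 'k) mpoly ring)"
  proof (rule abelian_groupI, unfold poly_ring_simps)
    fix p :: "('x, 'k) mpoly" assume "p \<in> pcarrier X"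
    then show "\<exists>q\<in>pcarrier X. q + p = 0"
      by (intro bexI[of _ "- p"]) (simp_all add: pcarrier_uminus)
  qed (simp_all add: pcarrier_intros algebra_simps)
  show "comm_monoid (poly_ring X :: ('x, 'k) mpoly ring)"
    by (rule comm_monoidI) (simp_all add: pcarrier_intros algebra_simps)
qed (simp add: algebra_simps)

lemma ideal_poly_ringI:
  assumes "J \<subseteq> pcarrier X" "0 \<in> J" "\<And>p q. p \<in> J \<Longrightarrow> q \<in> J \<Longrightarrow> p + q \<in> J"
    and mult: "\<And>p f. p \<in> J \<Longrightarrow> f \<in> pcarrier X \<Longrightarrow> f * p \<in> J"
  shows "ideal J (poly_ring X :: ('x, 'k::field) mpoly ring)"
proof (rule idealI)
  interpret cring "poly_ring X :: ('x, 'k) mpoly ring" by (rule cring_poly_ring)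
  show "ring (poly_ring X :: ('x, 'k) mpoly ring)" by (rule ring_axioms)
  show "subgroup J (add_monoid (poly_ring X))"
  proof (rule add.subgroupI)
    fix p assume p: "p \<in> J"
    then have "p \<in> pcarrier X" using assms(1) by blast
    moreover have "- p \<in> pcarrier X" using calculation by (rule pcarrier_uminus)
    ultimately have "\<ominus>\<^bsub>poly_ring X\<^esub> p = - p"
      by (intro minus_equality) simp_all
    moreover have "- 1 * p \<in> J"
      by (intro mult p pcarrier_intros)
    ultimately show "\<ominus>\<^bsub>poly_ring X\<^esub> p \<in> J"
      by simp
  qed (use assms in auto)
qed (use mult in \<open>auto simp: mult.commute\<close>)

lemma ideal_poly_ringD:
  assumes "ideal J (poly_ring X :: ('x, 'k::field) mpoly ring)"
  shows "0 \<in> J" "p \<in> J \<Longrightarrow> q \<in> J \<Longrightarrow> p + q \<in> J" "p \<in> J \<Longrightarrow> f \<in> pcarrier X \<Longrightarrow> f * p \<in> J"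
    "p \<in> J \<Longrightarrow> p \<in> pcarrier X"
  using additive_subgroup.zero_closed[OF ideal.axioms(1)[OF assms]]
    additive_subgroup.a_closed[OF ideal.axioms(1)[OF assms]]
    ideal.I_l_closed[OF assms] ideal.Icarr[OF assms] by auto

lemma ideal_poly_ring_sum:
  assumes "ideal J (poly_ring X :: ('x, 'k::field) mpoly ring)" "\<And>i. i \<in> A \<Longrightarrow> f i \<in> J"
  shows "sum f A \<in> J"
  using assms(2)
  by (induction A rule: infinite_finite_induct) (simp_all add: ideal_poly_ringD[OF assms(1)])


section \<open>Monomial ideals\<close>

definition divides_exp :: "('x \<Rightarrow>\<^sub>0 nat) \<Rightarrow> ('x \<Rightarrow>\<^sub>0 nat) \<Rightarrow> bool" where
  "divides_exp u v \<longleftrightarrow> (\<forall>x. Poly_Mapping.lookup u x \<le> Poly_Mapping.lookup v x)"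

lemma divides_exp_refl: "divides_exp u u"
  by (simp add: divides_exp_def)

lemma divides_exp_add: "divides_exp u v \<Longrightarrow> divides_exp u (w + v)"
  by (simp add: divides_exp_def lookup_add trans_le_add2)

lemma divides_expE:
  assumes "divides_exp u v" obtains w where "v = w + u"
proof
  show "v = (v - u) + u"
    using assms by (intro poly_mapping_eqI) (simp add: lookup_add lookup_minus divides_exp_def)
qed

lemma divides_exp_var: "divides_exp (Poly_Mapping.single x 1) u \<longleftrightarrow> x \<in> Poly_Mapping.keys u"
  by (auto simp: divides_exp_def lookup_single in_keys_iff when_def Suc_le_eq)

lemma mult_mono: "mono u * mono v = mono (u + v)"
  by (simp add: mono_def mult_single)

lemma prod_var: "finite C \<Longrightarrow> (\<Prod>c\<in>C. var c) = (mono (\<Sum>c\<in>C. Poly_Mapping.single c 1) :: ('x, 'k::field) mpoly)"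
proof (induction rule: finite_induct)
  case (insert c C)
  then show ?case by (simp add: var_def mult_mono)
qed (simp add: mono_def)

lemma mono_inject [simp]: "(mono u :: ('x, 'k::field) mpoly) = mono v \<longleftrightarrow> u = v"
  unfolding mono_def by (metis keys_single singleton_insert_inj_eq zero_neq_one)

text \<open>Adding \<open>u\<close> to exponent vectors is injective, so no terms cancel; for a
  general product \<open>keys_mult\<close> gives only an inclusion. Colon conditions thereby become
  statements about single exponents.\<close>

lemma keys_mult_mono:
  "Poly_Mapping.keys (f * mono u :: ('x, 'k::field) mpoly) = (\<lambda>w. w + u) ` Poly_Mapping.keys f"
proof -
  have "Poly_Mapping.lookup (f * mono u) (w + u) = Poly_Mapping.lookup f w" for w
  proof -
    have "(\<Sum>q. Poly_Mapping.lookup (mono u :: ('x,'k) mpoly) q when w + u = l + q) = (1 when w = l)" for l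
    proof -
      have "(\<lambda>q. Poly_Mapping.lookup (mono u :: ('x,'k) mpoly) q when w + u = l + q)
          = (\<lambda>q. (1 when w = l) when q = u)"
        by (auto simp: fun_eq_iff mono_def lookup_single when_def)
      then show ?thesis by (simp only: Sum_any_when_equal)
    qed
    then have "Poly_Mapping.lookup (f * mono u) (w + u) = (\<Sum>l. Poly_Mapping.lookup f l * (1 when w = l))"
      by (simp only: lookup_mult)
    also have "\<dots> = (\<Sum>l. Poly_Mapping.lookup f l when l = w)"
      by (rule arg_cong[of _ _ Sum_any]) (auto simp: when_def)
    finally show ?thesis
      by (simp only: Sum_any_when_equal)
  qed
  then have "(\<lambda>w. w + u) ` Poly_Mapping.keys f \<subseteq> Poly_Mapping.keys (f * mono u)"
    by (auto simp: in_keys_iff)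
  moreover have "Poly_Mapping.keys (mono u :: ('x,'k) mpoly) = {u}"
    by (simp add: mono_def)
  moreover have "{a + b | a b. a \<in> Poly_Mapping.keys f \<and> b \<in> {u}} = (\<lambda>w. w + u) ` Poly_Mapping.keys f"
    by auto
  ultimately show ?thesis
    using keys_mult[of f "mono u"] by (simp only: subset_antisym)
qed

lemma poly_mapping_expand: "p = (\<Sum>u\<in>Poly_Mapping.keys p. Poly_Mapping.single u (Poly_Mapping.lookup p u))"
  by (rule poly_mapping_eqI)
     (simp add: lookup_sum lookup_single when_def in_keys_iff)

text \<open>The right-hand side is an ideal containing the generators, and each term of such an
  \<open>f\<close> is a multiple of a generator. Membership in monomial ideals is thus reduced to
  divisibility of exponents.\<close>

lemma genideal_mono:
  assumes U: "\<And>u. u \<in> U \<Longrightarrow> Poly_Mapping.keys u \<subseteq> X"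
  shows "Idl\<^bsub>poly_ring X\<^esub> (mono ` U :: ('x, 'k::field) mpoly set) =
    {f \<in> pcarrier X. \<forall>w\<in>Poly_Mapping.keys f. \<exists>u\<in>U. divides_exp u w}" (is "_ = ?J")
proof
  interpret cring "poly_ring X :: ('x, 'k) mpoly ring" by (rule cring_poly_ring)
  have "ideal ?J (poly_ring X)"
  proof (rule ideal_poly_ringI)
    fix p f :: "('x, 'k) mpoly" assume p: "p \<in> ?J" and f: "f \<in> pcarrier X"
    have "\<exists>u\<in>U. divides_exp u w" if w: "w \<in> Poly_Mapping.keys (f * p)" for w
    proof -
      obtain a b where "w = a + b" "b \<in> Poly_Mapping.keys p"
        using w keys_mult[of f p] by blast
      then show ?thesis using p divides_exp_add by blast
    qed
    then show "f * p \<in> ?J"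
      using p f by (simp add: pcarrier_mult)
  next
    fix p q :: "('x, 'k) mpoly" assume "p \<in> ?J" "q \<in> ?J"
    then show "p + q \<in> ?J"
      using keys_add[of p q] by (auto intro: pcarrier_add)
  qed (auto intro: pcarrier_zero)
  moreover have "mono ` U \<subseteq> ?J"
    using U by (auto intro!: pcarrier_mono) (auto simp: mono_def intro: divides_exp_refl)
  ultimately show "Idl\<^bsub>poly_ring X\<^esub> (mono ` U) \<subseteq> ?J"
    by (rule genideal_minimal)
  have sub: "(mono ` U :: ('x, 'k) mpoly set) \<subseteq> pcarrier X"
    using U by (auto intro!: pcarrier_mono)
  have id: "ideal (Idl\<^bsub>poly_ring X\<^esub> (mono ` U)) (poly_ring X :: ('x, 'k) mpoly ring)"
    by (rule genideal_ideal[OF sub])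
  show "?J \<subseteq> Idl\<^bsub>poly_ring X\<^esub> (mono ` U)"
  proof
    fix f assume f: "f \<in> ?J"
    have "Poly_Mapping.single w (Poly_Mapping.lookup f w) \<in> Idl\<^bsub>poly_ring X\<^esub> (mono ` U)"
      if w: "w \<in> Poly_Mapping.keys f" for w
    proof -
      obtain u where u: "u \<in> U" "divides_exp u w" using f w by blast
      then obtain v where v: "w = v + u" by (elim divides_expE)
      have "Poly_Mapping.keys w \<subseteq> X" using f w by (auto simp: pcarrier_iff)
      then have "Poly_Mapping.keys v \<subseteq> X" using v by (simp add: keys_add_nat)
      then have "Poly_Mapping.single v (Poly_Mapping.lookup f w) \<in> pcarrier X"
        by (simp add: pcarrier_iff)
      then have "Poly_Mapping.single v (Poly_Mapping.lookup f w) * mono u \<in> Idl\<^bsub>poly_ring X\<^esub> (mono ` U)"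
        using genideal_self[OF sub] u by (intro ideal_poly_ringD(3)[OF id]) auto
      then show ?thesis by (simp add: mono_def mult_single v)
    qed
    then have "(\<Sum>w\<in>Poly_Mapping.keys f. Poly_Mapping.single w (Poly_Mapping.lookup f w))
        \<in> Idl\<^bsub>poly_ring X\<^esub> (mono ` U)"
      by (rule ideal_poly_ring_sum[OF id])
    then show "f \<in> Idl\<^bsub>poly_ring X\<^esub> (mono ` U)"
      using poly_mapping_expand[of f] by argo
  qed
qed

lemma genideal_var:
  assumes "Y \<subseteq> X"
  shows "Idl\<^bsub>poly_ring X\<^esub> (var ` Y :: ('x, 'k::field) mpoly set) =
    {f \<in> pcarrier X. \<forall>w\<in>Poly_Mapping.keys f. \<exists>y\<in>Y. y \<in> Poly_Mapping.keys w}"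
proof -
  have "(var ` Y :: ('x, 'k) mpoly set) = mono ` (\<lambda>x. Poly_Mapping.single x 1) ` Y"
    by (simp add: image_image var_def)
  moreover have "Poly_Mapping.keys u \<subseteq> X" if "u \<in> (\<lambda>x. Poly_Mapping.single x (1::nat)) ` Y" for u
    using that assms by auto
  ultimately show ?thesis
    by (simp add: genideal_mono divides_exp_var del: One_nat_def)
qed


section \<open>Homogeneous components\<close>

lemma mdeg_add: "mdeg (u + v) = mdeg u + mdeg v"
  unfolding mdeg_def by (rule setsum_keys_plus_distrib[of "\<lambda>_ n. n"]) auto

lemma mdeg_zero [simp]: "mdeg 0 = 0"
  by (simp add: mdeg_def)

lemma mdeg_single [simp]: "mdeg (Poly_Mapping.single x n) = n"
  by (simp add: mdeg_def)

lemma mdeg_eq_sum: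
  assumes "finite X" "Poly_Mapping.keys u \<subseteq> X"
  shows "mdeg u = (\<Sum>x\<in>X. Poly_Mapping.lookup u x)"
  unfolding mdeg_def using assms by (intro sum.mono_neutral_left) (auto simp: in_keys_iff)

lemma homogeneous_zero: "homogeneous d 0"
  by (simp add: homogeneous_def)

lemma homogeneous_mono: "homogeneous (mdeg u) (mono u)"
  by (simp add: homogeneous_def mono_def)

lemma homogeneous_var: "homogeneous 1 (var x)"
  by (simp add: homogeneous_def mono_def var_def)

lemma homogeneous_uminus: "homogeneous d p \<Longrightarrow> homogeneous d (- p)"
  by (simp add: homogeneous_def keys_uminus_eq)

lemma homogeneous_mult: "homogeneous d p \<Longrightarrow> homogeneous e q \<Longrightarrow> homogeneous (d + e) (p * q)"
  unfolding homogeneous_def using keys_mult[of p q] by (fastforce simp: mdeg_add)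

definition hom_part :: "nat \<Rightarrow> ('x, 'k::field) mpoly \<Rightarrow> ('x, 'k) mpoly" where
  "hom_part d p = Poly_Mapping.mapp (\<lambda>u c. c when mdeg u = d) p"

lemma lookup_hom_part: "Poly_Mapping.lookup (hom_part d p) u = (Poly_Mapping.lookup p u when mdeg u = d)"
  by (simp add: hom_part_def lookup_mapp when_def in_keys_iff)

lemma keys_hom_part: "Poly_Mapping.keys (hom_part d p) = {u \<in> Poly_Mapping.keys p. mdeg u = d}"
  by (auto simp: in_keys_iff lookup_hom_part)

lemma homogeneous_hom_part: "homogeneous d (hom_part d p)"
  by (simp add: homogeneous_def keys_hom_part)

lemma hom_part_homogeneous: "homogeneous d p \<Longrightarrow> hom_part d p = p"
  by (rule poly_mapping_eqI) (auto simp: lookup_hom_part when_def homogeneous_def in_keys_iff)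

lemma hom_part_eq_0: "(\<And>u. u \<in> Poly_Mapping.keys p \<Longrightarrow> mdeg u \<noteq> d) \<Longrightarrow> hom_part d p = 0"
  by (rule poly_mapping_eqI) (auto simp: lookup_hom_part when_def in_keys_iff)

lemma hom_part_add: "hom_part d (p + q) = hom_part d p + hom_part d q"
  by (rule poly_mapping_eqI) (simp add: lookup_hom_part lookup_add when_def)

lemma hom_part_sum: "hom_part d (sum f A) = (\<Sum>i\<in>A. hom_part d (f i))"
  by (rule poly_mapping_eqI) (simp add: lookup_hom_part lookup_sum when_def)

lemma hom_part_pcarrier: "p \<in> pcarrier X \<Longrightarrow> hom_part d p \<in> pcarrier X"
  by (simp add: pcarrier_iff keys_hom_part)

lemma hom_part_mult:
  assumes "homogeneous e p"
  shows "hom_part (d + e) (f * p) = hom_part d f * p"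
proof -
  \<comment> \<open>\<open>g\<close> collects the terms of \<open>f\<close> of degree other than
    \<open>d\<close>; after multiplication by the homogeneous \<open>p\<close> they all miss degree
    \<open>d + e\<close>.\<close>
  define g where "g = f - hom_part d f"
  have "mdeg w \<noteq> d" if "w \<in> Poly_Mapping.keys g" for w
    using that by (auto simp: g_def in_keys_iff lookup_minus lookup_hom_part)
  then have "hom_part (d + e) (g * p) = 0"
    using keys_mult[of g p] assms by (intro hom_part_eq_0) (fastforce simp: homogeneous_def mdeg_add)
  moreover have "hom_part (d + e) (hom_part d f * p) = hom_part d f * p"
    using homogeneous_hom_part assms by (intro hom_part_homogeneous homogeneous_mult)
  moreover have "f * p = hom_part d f * p + g * p"
    by (simp add: g_def algebra_simps)
  ultimately show ?thesis
    by (simp add: hom_part_add)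
qed


section \<open>Modules with linear quotients\<close>

text \<open>Elements of a free module are functions on \<open>nat\<close>; the finite rank is imposed where needed by
  demanding that almost all coordinates vanish. In this way a syzygy of \<open>gs\<close> is literally also a
  syzygy of \<open>gs @ [g]\<close>.\<close>

definition lin_comb :: "(nat \<Rightarrow> ('x, 'k::field) mpoly) list \<Rightarrow> (nat \<Rightarrow> ('x, 'k) mpoly) \<Rightarrow> nat \<Rightarrow> ('x, 'k) mpoly" where
  "lin_comb gs c = (\<lambda>r. \<Sum>j<length gs. c j * (gs ! j) r)"

definition span_vecs :: "'x set \<Rightarrow> (nat \<Rightarrow> ('x, 'k::field) mpoly) list \<Rightarrow> (nat \<Rightarrow> ('x, 'k) mpoly) set" where
  "span_vecs X gs = {lin_comb gs c | c. \<forall>j. c j \<in> pcarrier X}"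

definition syzygies :: "'x set \<Rightarrow> (nat \<Rightarrow> ('x, 'k::field) mpoly) list \<Rightarrow> (nat \<Rightarrow> ('x, 'k) mpoly) set" where
  "syzygies X gs =
     {c. (\<forall>j. c j \<in> pcarrier X) \<and> (\<forall>j\<ge>length gs. c j = 0) \<and> lin_comb gs c = (\<lambda>_. 0)}"

text \<open>The last condition says that the colon ideal of the span of \<open>gs\<close> by
  \<open>g\<close> is generated by the variables in \<open>Y\<close>. A single degree
  \<open>d\<close> for all generators is what makes the new syzygies linear.\<close>

inductive lin_quot :: "'x set \<Rightarrow> nat \<Rightarrow> (nat \<Rightarrow> ('x, 'k::field) mpoly) list \<Rightarrow> bool" for X d where
  Nil: "lin_quot X d []"
| snoc: "lin_quot X d gs \<Longrightarrow> Y \<subseteq> X \<Longrightarrow> (\<And>r. g r \<in> pcarrier X) \<Longrightarrow> (\<And>r. homogeneous d (g r)) \<Longrightarrow>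
    (\<And>f. f \<in> pcarrier X \<Longrightarrow> (\<lambda>r. f * g r) \<in> span_vecs X gs \<longleftrightarrow> f \<in> Idl\<^bsub>poly_ring X\<^esub> (var ` Y)) \<Longrightarrow>
    lin_quot X d (gs @ [g])"

lemma lin_comb_cong: "(\<And>j. j < length gs \<Longrightarrow> c j = c' j) \<Longrightarrow> lin_comb gs c = lin_comb gs c'"
  by (simp add: lin_comb_def)

lemma lin_comb_Nil [simp]: "lin_comb [] c = (\<lambda>_. 0)"
  by (simp add: lin_comb_def)

lemma lin_comb_snoc: "lin_comb (gs @ [g]) c = (\<lambda>r. lin_comb gs c r + c (length gs) * g r)"
  by (simp add: lin_comb_def nth_append)

lemma lin_comb_diff: "lin_comb gs (\<lambda>j. c j - f * c' j) r = lin_comb gs c r - f * lin_comb gs c' r"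
  by (simp add: lin_comb_def algebra_simps sum_subtractf sum_distrib_left)

lemma lin_comb_uminus: "lin_comb gs (\<lambda>j. - c j) r = - lin_comb gs c r"
  by (simp add: lin_comb_def sum_negf)

lemma span_vecs_Nil: "span_vecs X [] = {\<lambda>_. 0}"
  by (auto simp: span_vecs_def intro: exI[of _ "\<lambda>_. 0"] pcarrier_zero)

lemma span_vecs_snoc:
  "v \<in> span_vecs X (gs @ [g]) \<longleftrightarrow> (\<exists>f\<in>pcarrier X. (\<lambda>r. v r - f * g r) \<in> span_vecs X gs)"
proof
  assume "v \<in> span_vecs X (gs @ [g])"
  then obtain c where c: "v = lin_comb (gs @ [g]) c" "\<forall>j. c j \<in> pcarrier X"
    by (auto simp: span_vecs_def)
  then have "(\<lambda>r. v r - c (length gs) * g r) = lin_comb gs c"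
    by (simp add: lin_comb_snoc)
  with c show "\<exists>f\<in>pcarrier X. (\<lambda>r. v r - f * g r) \<in> span_vecs X gs"
    by (intro bexI[of _ "c (length gs)"]) (auto simp: span_vecs_def)
next
  assume "\<exists>f\<in>pcarrier X. (\<lambda>r. v r - f * g r) \<in> span_vecs X gs"
  then obtain f c where f: "f \<in> pcarrier X" "(\<lambda>r. v r - f * g r) = lin_comb gs c"
    and c: "\<forall>j. c j \<in> pcarrier X"
    by (auto simp: span_vecs_def)
  have "lin_comb gs (c(length gs := f)) = lin_comb gs c"
    by (rule lin_comb_cong) simp
  then have "v = lin_comb (gs @ [g]) (c(length gs := f))"
    using f(2) by (simp add: lin_comb_snoc fun_eq_iff algebra_simps)
  with f(1) c show "v \<in> span_vecs X (gs @ [g])"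
    unfolding span_vecs_def by (intro CollectI exI[of _ "c(length gs := f)"]) simp
qed

lemma nth_mem_span_vecs:
  assumes "g \<in> set gs"
  shows "g \<in> span_vecs X gs"
proof -
  obtain i where i: "i < length gs" "gs ! i = g"
    using assms by (auto simp: in_set_conv_nth)
  define c where "c j = (if j = i then 1 else 0 :: ('a, 'b) mpoly)" for j
  have "lin_comb gs c r = g r" for r
  proof -
    have "c j * (gs ! j) r = (if j = i then (gs ! j) r else 0)" for j
      by (simp add: c_def)
    with i show ?thesis by (simp add: lin_comb_def)
  qed
  then have "g = lin_comb gs c" by auto
  moreover have "c j \<in> pcarrier X" for j
    by (simp add: c_def pcarrier_intros)
  ultimately show ?thesis by (auto simp: span_vecs_def)
qed

lemma lin_quot_homogeneous:
  assumes "lin_quot X d gs" "g \<in> set gs"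
  shows "g r \<in> pcarrier X \<and> homogeneous d (g r)"
  using assms by (induction rule: lin_quot.induct) auto

text \<open>Comparing homogeneous components of degree \<open>d + 1\<close>.\<close>

lemma linear_coefficients:
  assumes gs: "\<And>h r. h \<in> set gs \<Longrightarrow> homogeneous d (h r)" and g: "\<And>r. homogeneous d (g r)"
    and span: "(\<lambda>r. var y * g r) \<in> span_vecs X gs"
  obtains c where "\<And>j. c j \<in> pcarrier X" "\<And>j. homogeneous 1 (c j)" "\<And>j. j \<ge> length gs \<Longrightarrow> c j = 0"
    "\<And>r. lin_comb gs c r = var y * g r"
proof -
  obtain c where c: "(\<lambda>r. var y * g r) = lin_comb gs c" "\<forall>j. c j \<in> pcarrier X"
    using span by (auto simp: span_vecs_def)
  \<comment> \<open>Only the linear parts of the coefficients contribute in degree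
    \<open>1 + d\<close>. The value 0 past the end is what the coordinates of a syzygy
    require.\<close>
  define c' where "c' j = (if j < length gs then hom_part 1 (c j) else 0)" for j
  have "lin_comb gs c' r = var y * g r" for r
  proof -
    have "lin_comb gs c' r = (\<Sum>j<length gs. hom_part (1 + d) (c j * (gs ! j) r))"
      unfolding lin_comb_def c'_def using gs by (intro sum.cong) (auto simp only: hom_part_mult nth_mem lessThan_iff if_True)
    also have "\<dots> = hom_part (1 + d) (lin_comb gs c r)"
      by (simp only: lin_comb_def hom_part_sum)
    also have "\<dots> = hom_part (1 + d) (var y * g r)"
      using c(1) by (simp only: fun_eq_iff)
    also have "\<dots> = var y * g r"
      using g homogeneous_var by (intro hom_part_homogeneous homogeneous_mult)
    finally show ?thesis .
  qed
  with c(2) show thesis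
    by (intro that[of c']) (auto simp: c'_def hom_part_pcarrier homogeneous_hom_part homogeneous_zero pcarrier_zero)
qed

section \<open>Adjoining a generator, and ideals generated by variables\<close>

lemma genideal_poly_ring_empty: "Idl\<^bsub>poly_ring X\<^esub> {} = {0 :: ('x, 'k::field) mpoly}"
proof -
  interpret cring "poly_ring X :: ('x, 'k) mpoly ring" by (rule cring_poly_ring)
  show ?thesis
    using genideal_minimal[OF zeroideal, of "{}"] ideal_poly_ringD(1)[OF genideal_ideal[of "{}"]]
    by auto
qed

text \<open>The ideal counterpart of \<open>span_vecs_snoc\<close>: with both in the same form,
  spans of vectors and ideals can be compared by one induction over the list of generators.\<close>

lemma genideal_insert:
  assumes "insert a A \<subseteq> pcarrier X"
  shows "p \<in> Idl\<^bsub>poly_ring X\<^esub> (insert a A :: ('x, 'k::field) mpoly set) \<longleftrightarrow>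
    (\<exists>f\<in>pcarrier X. p - f * a \<in> Idl\<^bsub>poly_ring X\<^esub> A)"
proof -
  interpret cring "poly_ring X :: ('x, 'k) mpoly ring" by (rule cring_poly_ring)
  let ?I = "Idl\<^bsub>poly_ring X\<^esub> (insert a A)"
  let ?J = "Idl\<^bsub>poly_ring X\<^esub> A"
  from assms have I: "ideal ?I (poly_ring X)" and J: "ideal ?J (poly_ring X)"
    by (auto intro!: genideal_ideal)
  let ?K = "{p \<in> pcarrier X. \<exists>f\<in>pcarrier X. p - f * a \<in> ?J}"
  have "ideal ?K (poly_ring X)"
  proof (rule ideal_poly_ringI)
    show "0 \<in> ?K"
      using ideal_poly_ringD(1)[OF J] by (auto intro!: pcarrier_zero bexI[of _ 0])
  next
    fix p q assume "p \<in> ?K" "q \<in> ?K"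
    then obtain f g where pq: "p \<in> pcarrier X" "q \<in> pcarrier X" and "f \<in> pcarrier X" "g \<in> pcarrier X"
      "p - f * a \<in> ?J" "q - g * a \<in> ?J" by blast
    moreover from this have "p + q - (f + g) * a \<in> ?J"
      using ideal_poly_ringD(2)[OF J, of "p - f * a" "q - g * a"] by (simp add: algebra_simps)
    ultimately show "p + q \<in> ?K" by (blast intro: pcarrier_add)
  next
    fix p h :: "('x, 'k) mpoly" assume "p \<in> ?K" and h: "h \<in> pcarrier X"
    then obtain f where "p \<in> pcarrier X" "f \<in> pcarrier X" "p - f * a \<in> ?J" by blast
    moreover from this have "h * p - (h * f) * a \<in> ?J"
      using ideal_poly_ringD(3)[OF J, of "p - f * a" h] h by (simp add: algebra_simps)
    ultimately show "h * p \<in> ?K" using h by (blast intro: pcarrier_mult)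
  qed auto
  moreover have "insert a A \<subseteq> ?K"
  proof -
    have "a \<in> ?K"
      using assms ideal_poly_ringD(1)[OF J] by (auto intro!: bexI[of _ 1] pcarrier_one)
    moreover have "z \<in> ?K" if "z \<in> A" for z
      using assms that genideal_self[of A] by (auto intro!: bexI[of _ 0] pcarrier_zero)
    ultimately show ?thesis by blast
  qed
  ultimately have "?I \<subseteq> ?K"
    by (rule genideal_minimal)
  moreover have "p \<in> ?I" if "f \<in> pcarrier X" "p - f * a \<in> ?J" for f
  proof -
    have "?J \<subseteq> ?I"
      using assms genideal_self[of "insert a A"] I by (intro genideal_minimal) auto
    moreover have "f * a \<in> ?I"
      using assms genideal_self[of "insert a A"] that(1) by (intro ideal_poly_ringD(3)[OF I]) auto
    ultimately have "(p - f * a) + f * a \<in> ?I"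
      using that(2) by (intro ideal_poly_ringD(2)[OF I]) auto
    then show ?thesis by simp
  qed
  ultimately show ?thesis by blast
qed

lemma genideal_var_self:
  assumes "Y \<subseteq> X" "y \<in> Y"
  shows "var y \<in> Idl\<^bsub>poly_ring X\<^esub> (var ` Y :: ('x, 'k::field) mpoly set)"
proof -
  interpret cring "poly_ring X :: ('x, 'k) mpoly ring" by (rule cring_poly_ring)
  show ?thesis
    using assms genideal_self[of "var ` Y"] by (auto intro: pcarrier_var)
qed

text \<open>A variable outside \<open>Y\<close> is a nonzerodivisor modulo the ideal generated by
  \<open>Y\<close>: it adds only \<open>y\<close> to the support of each exponent, which does not
  affect divisibility by variables in \<open>Y\<close>.\<close>

lemma mult_var_mem_genideal_var:
  assumes "Y \<subseteq> X" "y \<in> X" "y \<notin> Y" "f \<in> pcarrier X"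
  shows "f * var y \<in> Idl\<^bsub>poly_ring X\<^esub> (var ` Y :: ('x, 'k::field) mpoly set) \<longleftrightarrow>
    f \<in> Idl\<^bsub>poly_ring X\<^esub> (var ` Y)"
proof -
  have "Poly_Mapping.keys (f * var y) = (\<lambda>w. w + Poly_Mapping.single y 1) ` Poly_Mapping.keys f"
    by (simp add: var_def keys_mult_mono)
  then show ?thesis
    using assms pcarrier_mult[OF assms(4) pcarrier_var[OF assms(2)]]
    by (auto simp: genideal_var keys_add_nat)
qed

text \<open>The syzygies of \<open>gs @ [g]\<close> are those of \<open>gs\<close> together with one syzygy with last coordinate
  \<open>var y\<close> for each variable \<open>y\<close> of the colon ideal. The colon ideals of the latter can be read off
  from the last coordinate, so that they are again generated by variables.\<close>

lemma lin_quot_syzygies: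
  assumes "finite X" "lin_quot X d gs"
  shows "\<exists>ss. lin_quot X 1 ss \<and> span_vecs X ss = syzygies X gs"
  using assms(2)
proof (induction rule: lin_quot.induct)
  case Nil
  have "syzygies X [] = {\<lambda>_. 0 :: ('a, 'b) mpoly}"
    by (auto simp: syzygies_def pcarrier_zero)
  then show ?case
    using lin_quot.Nil span_vecs_Nil by metis
next
  case (snoc gs Y g)
  then obtain ss where ss: "lin_quot X 1 ss" "span_vecs X ss = syzygies X gs" by blast
  let ?n = "length gs"
  let ?syz = "syzygies X (gs @ [g])"
  let ?I = "\<lambda>A. Idl\<^bsub>poly_ring X\<^esub> (var ` A) :: ('a, 'b) mpoly set"
  have "\<exists>c. (\<forall>j. c j \<in> pcarrier X) \<and> (\<forall>j. homogeneous 1 (c j)) \<and> (\<forall>j\<ge>?n. c j = 0) \<and>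
      (\<forall>r. lin_comb gs c r = var y * g r)" if "y \<in> Y" for y
  proof -
    have "(\<lambda>r. var y * g r) \<in> span_vecs X gs"
      using that snoc.hyps(2) genideal_var_self by (subst snoc.hyps(5)) (auto intro!: pcarrier_var)
    then show ?thesis
      using snoc.hyps lin_quot_homogeneous[OF snoc.hyps(1)] by (elim linear_coefficients[rotated 2]) auto
  qed
  then obtain c where c: "\<And>y j. y \<in> Y \<Longrightarrow> c y j \<in> pcarrier X" "\<And>y j. y \<in> Y \<Longrightarrow> homogeneous 1 (c y j)"
    "\<And>y j. y \<in> Y \<Longrightarrow> j \<ge> ?n \<Longrightarrow> c y j = 0" "\<And>y r. y \<in> Y \<Longrightarrow> lin_comb gs (c y) r = var y * g r"
    by metis
  \<comment> \<open>The relation equating \<open>var y\<close> times \<open>g\<close> with its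
    expression through \<open>gs\<close>. Past index \<open>?n\<close> it vanishes because
    \<open>c y\<close> does, as membership in \<open>?syz\<close> demands.\<close>
  define s where "s y j = (if j = ?n then var y else - c y j)" for y j
  have s_last: "s y ?n = var y" for y
    by (simp add: s_def)
  have s_carr: "s y j \<in> pcarrier X" "homogeneous 1 (s y j)" if "y \<in> Y" for y j
    using c(1,2)[OF that] that snoc.hyps(2)
    by (auto simp: s_def pcarrier_var pcarrier_uminus homogeneous_var[unfolded One_nat_def] homogeneous_uminus)
  have s_lin: "lin_comb (gs @ [g]) (s y) r = 0" if "y \<in> Y" for y r
  proof -
    have "lin_comb gs (s y) = lin_comb gs (\<lambda>j. - c y j)"
      by (rule lin_comb_cong) (simp add: s_def)
    then show ?thesis
      using c(4)[OF that, of r] by (simp add: lin_comb_snoc lin_comb_uminus s_last)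
  qed
  have shift: "(\<lambda>j. v j - f * s y j) \<in> ?syz \<longleftrightarrow> v \<in> ?syz" if "y \<in> Y" "f \<in> pcarrier X" for v f y
  proof -
    have "v j - f * s y j \<in> pcarrier X \<longleftrightarrow> v j \<in> pcarrier X" for j
      using pcarrier_mult[OF that(2) s_carr(1)[OF that(1), of j]]
        pcarrier_add[of "v j - f * s y j" X "f * s y j"] pcarrier_minus[of "v j" X "f * s y j"] by auto
    moreover have "v j - f * s y j = 0 \<longleftrightarrow> v j = 0" if "j \<ge> length (gs @ [g])" for j
      using that c(3)[OF \<open>y \<in> Y\<close>, of j] by (simp add: s_def)
    ultimately show ?thesis
      using s_lin[OF that(1)] by (simp add: syzygies_def fun_eq_iff lin_comb_diff)
  qed
  \<comment> \<open>Invariant: once the variables \<open>ys\<close> are treated, exactly the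
    syzygies with last coordinate in the ideal of \<open>ys\<close> are spanned. For empty
    \<open>ys\<close> these are the syzygies of \<open>gs\<close>; for \<open>ys\<close> exhausting
    \<open>Y\<close> they are all syzygies.\<close>
  have main: "lin_quot X 1 (ss @ map s ys) \<and>
      (\<forall>v. v \<in> span_vecs X (ss @ map s ys) \<longleftrightarrow> v \<in> ?syz \<and> v ?n \<in> ?I (set ys))"
    if "distinct ys" "set ys \<subseteq> Y" for ys
    using that
  proof (induction ys rule: rev_induct)
    case Nil
    have I0: "?I {} = {0}"
      by (simp only: image_empty genideal_poly_ring_empty)
    have "v \<in> syzygies X gs \<longleftrightarrow> v \<in> ?syz \<and> v ?n = 0" for v
      by (auto simp: syzygies_def lin_comb_snoc le_Suc_eq Suc_le_eq dest: le_neq_implies_less)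
    with ss I0 show ?case by simp
  next
    case (snoc y ys)
    then have y: "y \<in> Y" "y \<notin> set ys" "set ys \<subseteq> Y" "y \<in> X" "set ys \<subseteq> X"
      using \<open>Y \<subseteq> X\<close> by auto
    from snoc y have IH: "lin_quot X 1 (ss @ map s ys)"
      "\<And>v. v \<in> span_vecs X (ss @ map s ys) \<longleftrightarrow> v \<in> ?syz \<and> v ?n \<in> ?I (set ys)"
      by auto
    \<comment> \<open>The multiple is already spanned iff its last coordinate
      \<open>f * var y\<close> lies in the ideal of \<open>ys\<close>, hence iff \<open>f\<close>
      does, since \<open>y\<close> does not occur in \<open>ys\<close>.\<close>
    have "(\<lambda>j. f * s y j) \<in> span_vecs X (ss @ map s ys) \<longleftrightarrow> f \<in> ?I (set ys)" if f: "f \<in> pcarrier X" for f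
    proof -
      have "(\<lambda>_. 0) \<in> ?syz"
        by (simp add: syzygies_def pcarrier_zero lin_comb_def)
      then have "(\<lambda>j. f * s y j) \<in> ?syz"
        using shift[OF y(1) pcarrier_uminus[OF f], of "\<lambda>_. 0"] by simp
      then show ?thesis
        using IH(2) y f by (simp add: s_last mult_var_mem_genideal_var)
    qed
    then have "lin_quot X 1 ((ss @ map s ys) @ [s y])"
      using IH(1) y s_carr by (intro lin_quot.snoc[of _ _ _ "set ys"]) auto
    moreover have "v \<in> span_vecs X ((ss @ map s ys) @ [s y]) \<longleftrightarrow> v \<in> ?syz \<and> v ?n \<in> ?I (insert y (set ys))" for v
    proof -
      have ins: "insert (var y) (var ` set ys) \<subseteq> (pcarrier X :: ('a, 'b) mpoly set)"
        using y by (auto intro: pcarrier_var)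
      then show ?thesis
        unfolding span_vecs_snoc IH(2) s_last image_insert genideal_insert[OF ins]
        using shift[OF y(1)] by blast
    qed
    ultimately show ?case by simp
  qed
  obtain ys where ys: "distinct ys" "set ys = Y"
    using finite_distinct_list[of Y] finite_subset[OF snoc.hyps(2) assms(1)] by blast
  \<comment> \<open>A syzygy expresses \<open>v ?n * g\<close> through \<open>gs\<close>, so its
    last coordinate lies in the colon ideal.\<close>
  have "v ?n \<in> ?I Y" if v: "v \<in> ?syz" for v
  proof -
    have vn: "v ?n \<in> pcarrier X" and eq: "\<And>r. lin_comb gs v r + v ?n * g r = 0"
      using v by (auto simp: syzygies_def lin_comb_snoc fun_eq_iff)
    have "(\<lambda>r. v ?n * g r) = lin_comb gs (\<lambda>j. - v j)"
      using eq by (simp add: fun_eq_iff lin_comb_uminus eq_neg_iff_add_eq_0 add.commute)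
    then have "(\<lambda>r. v ?n * g r) \<in> span_vecs X gs"
      using v unfolding span_vecs_def
      by (intro CollectI exI[of _ "\<lambda>j. - v j"]) (simp add: syzygies_def pcarrier_uminus)
    with snoc.hyps(5)[OF vn] show ?thesis by simp
  qed
  then show ?case
    using main[of ys] ys by (intro exI[of _ "ss @ map s ys"]) auto
qed


section \<open>The linear resolution\<close>

lemma mat_mult_lin_comb:
  assumes "dim_vec v = length gs"
  shows "mat n (length gs) (\<lambda>(r, j). (gs ! j) r) *\<^sub>v v = vec n (lin_comb gs (\<lambda>j. v $ j))"
proof (rule eq_vecI)
  fix r assume "r < dim_vec (vec n (lin_comb gs (\<lambda>j. v $ j)))"
  then show "(mat n (length gs) (\<lambda>(r, j). (gs ! j) r) *\<^sub>v v) $ r = vec n (lin_comb gs (\<lambda>j. v $ j)) $ r"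
    using assms by (auto simp: lin_comb_def scalar_prod_def atLeast0LessThan mult.commute intro!: sum.cong)
qed simp

lemma image_mat_span_vecs:
  "{mat n (length gs) (\<lambda>(r, j). (gs ! j) r) *\<^sub>v v | v. v \<in> free_module X (length gs)}
    = {vec n v | v. v \<in> span_vecs X gs}"
proof (intro equalityI subsetI)
  fix w assume "w \<in> {mat n (length gs) (\<lambda>(r, j). (gs ! j) r) *\<^sub>v v | v. v \<in> free_module X (length gs)}"
  then obtain v where v: "v \<in> free_module X (length gs)" "w = vec n (lin_comb gs (\<lambda>j. v $ j))"
    by (auto simp: mat_mult_lin_comb free_module_def)
  \<comment> \<open>Entries of \<open>v\<close> beyond its dimension are unspecified, whereas
    \<open>span_vecs\<close> wants every coefficient in the ring.\<close>
  let ?c = "\<lambda>j. if j < length gs then v $ j else 0"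
  have "lin_comb gs (\<lambda>j. v $ j) = lin_comb gs ?c"
    by (rule lin_comb_cong) simp
  moreover have "\<forall>j. ?c j \<in> pcarrier X"
    using v(1) by (simp add: free_module_def pcarrier_zero)
  ultimately have "lin_comb gs (\<lambda>j. v $ j) \<in> span_vecs X gs"
    unfolding span_vecs_def by blast
  then show "w \<in> {vec n v | v. v \<in> span_vecs X gs}"
    using v(2) by blast
next
  fix w assume "w \<in> {vec n v | v. v \<in> span_vecs X gs}"
  then obtain c where c: "w = vec n (lin_comb gs c)" "\<forall>j. c j \<in> pcarrier X"
    by (auto simp: span_vecs_def)
  have "lin_comb gs (\<lambda>j. vec (length gs) c $ j) = lin_comb gs c"
    by (rule lin_comb_cong) simp
  then have "w = mat n (length gs) (\<lambda>(r, j). (gs ! j) r) *\<^sub>v vec (length gs) c"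
    using c(1) by (simp add: mat_mult_lin_comb)
  moreover have "vec (length gs) c \<in> free_module X (length gs)"
    using c(2) by (simp add: free_module_def)
  ultimately show "w \<in> {mat n (length gs) (\<lambda>(r, j). (gs ! j) r) *\<^sub>v v | v. v \<in> free_module X (length gs)}"
    by blast
qed

text \<open>The matrix sees only the first \<open>n\<close> coordinates, while
  \<open>syzygies\<close> demands the relation in all of them; the hypothesis that the generators
  vanish from \<open>n\<close> on closes this gap.\<close>

lemma kernel_mat_syzygies:
  assumes "\<And>g r. g \<in> set gs \<Longrightarrow> r \<ge> n \<Longrightarrow> g r = 0"
  shows "{v \<in> free_module X (length gs). mat n (length gs) (\<lambda>(r, j). (gs ! j) r) *\<^sub>v v = 0\<^sub>v n}
    = {vec (length gs) c | c. c \<in> syzygies X gs}"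
proof (intro equalityI subsetI)
  fix v assume "v \<in> {v \<in> free_module X (length gs). mat n (length gs) (\<lambda>(r, j). (gs ! j) r) *\<^sub>v v = 0\<^sub>v n}"
  then have v: "v \<in> free_module X (length gs)" and "vec n (lin_comb gs (\<lambda>j. v $ j)) = 0\<^sub>v n"
    by (auto simp: mat_mult_lin_comb free_module_def)
  then have lt: "lin_comb gs (\<lambda>j. v $ j) r = 0" if "r < n" for r
    using that by (metis index_vec index_zero_vec(1))
  let ?c = "\<lambda>j. if j < length gs then v $ j else 0"
  have "lin_comb gs ?c r = 0" for r
  proof (cases "r < n")
    case True
    have "lin_comb gs ?c = lin_comb gs (\<lambda>j. v $ j)"
      by (rule lin_comb_cong) simp
    then show ?thesis using lt True by simp
  next
    case False
    then have "(gs ! j) r = 0" if "j < length gs" for j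
      using that by (intro assms) auto
    then show ?thesis by (simp add: lin_comb_def)
  qed
  then have "?c \<in> syzygies X gs"
    using v by (auto simp: syzygies_def free_module_def pcarrier_zero)
  moreover have "v = vec (length gs) ?c"
    using v by (intro eq_vecI) (auto simp: free_module_def)
  ultimately show "v \<in> {vec (length gs) c | c. c \<in> syzygies X gs}"
    by blast
next
  fix v assume "v \<in> {vec (length gs) c | c. c \<in> syzygies X gs}"
  then obtain c where c: "v = vec (length gs) c" "c \<in> syzygies X gs" by blast
  have "lin_comb gs (\<lambda>j. v $ j) = lin_comb gs c"
    using c(1) by (intro lin_comb_cong) simp
  also have "\<dots> = (\<lambda>_. 0)"
    using c(2) by (simp add: syzygies_def)
  finally have "mat n (length gs) (\<lambda>(r, j). (gs ! j) r) *\<^sub>v v = 0\<^sub>v n"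
    using c(1) by (simp add: mat_mult_lin_comb zero_vec_def)
  moreover have "v \<in> free_module X (length gs)"
    using c by (simp add: free_module_def syzygies_def)
  ultimately show "v \<in> {v \<in> free_module X (length gs). mat n (length gs) (\<lambda>(r, j). (gs ! j) r) *\<^sub>v v = 0\<^sub>v n}"
    by blast
qed

lemma linear_resolution_of_lin_quot:
  fixes gs :: "(nat \<Rightarrow> ('x, 'k::field) mpoly) list"
  assumes fin: "finite X" and gs: "lin_quot X q gs" and rank1: "\<And>g r. g \<in> set gs \<Longrightarrow> r \<ge> 1 \<Longrightarrow> g r = 0"
  shows "linear_resolution X {v 0 | v. v \<in> span_vecs X gs}"
proof -
  \<comment> \<open>The choice is meaningful when \<open>hs\<close> has linear quotients, which
    \<open>lq\<close> below guarantees at every stage of the iteration.\<close>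
  define syz where "syz hs = (SOME ss. lin_quot X 1 ss \<and> span_vecs X ss = syzygies X hs)"
    for hs :: "(nat \<Rightarrow> ('x, 'k) mpoly) list"
  define F where "F = rec_nat gs (\<lambda>_. syz)"
  define n where "n i = (case i of 0 \<Rightarrow> 1 | Suc i' \<Rightarrow> length (F i'))" for i
  define D where "D i = mat (n i) (length (F i)) (\<lambda>(r, j). (F i ! j) r)" for i
  \<comment> \<open>\<open>F 0\<close> has degree \<open>q\<close> and each later differential has
    linear entries, so the shift grows by one per step.\<close>
  define sh where "sh i = replicate (length (F i)) (q + i)" for i
  have F0: "F 0 = gs" and FS: "F (Suc i) = syz (F i)" for i
    by (simp_all add: F_def)
  have n0: "n 0 = 1" and nS: "n (Suc i) = length (F i)" for i
    by (simp_all add: n_def)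
  have syz: "lin_quot X 1 (syz hs) \<and> span_vecs X (syz hs) = syzygies X hs" if "lin_quot X e hs" for e hs
    unfolding syz_def using lin_quot_syzygies[OF fin that] by (rule someI_ex)
  have lq: "lin_quot X (if i = 0 then q else 1) (F i)" for i
    by (induction i) (use gs syz FS in \<open>auto simp: F0\<close>)
  have exact: "span_vecs X (F (Suc i)) = syzygies X (F i)" for i
    using syz[OF lq] by (simp add: FS)
  have rank: "g r = 0" if "g \<in> set (F i)" "r \<ge> n i" for g r i
  proof (cases i)
    case 0
    then show ?thesis using that rank1 by (simp add: F0 n0)
  next
    case (Suc i')
    then have "g \<in> syzygies X (F i')"
      using nth_mem_span_vecs[OF that(1)] exact by auto
    then show ?thesis using that(2) by (simp add: syzygies_def Suc nS)
  qed
  have entry: "D i $$ (r, j) \<in> pcarrier X \<and> homogeneous (if i = 0 then q else 1) (D i $$ (r, j))"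
    if "r < n i" "j < length (F i)" for i r j
    using that lin_quot_homogeneous[OF lq[of i], of "F i ! j" r] by (simp add: D_def)
  have "{(D 0 *\<^sub>v v) $ 0 | v. v \<in> free_module X (length (sh 0))}
      = (\<lambda>w. w $ 0) ` {D 0 *\<^sub>v v | v. v \<in> free_module X (length (F 0))}"
    by (auto simp: sh_def)
  also have "\<dots> = (\<lambda>w. w $ 0) ` {vec (n 0) v | v. v \<in> span_vecs X (F 0)}"
    by (simp only: D_def image_mat_span_vecs)
  also have "\<dots> = {v 0 | v. v \<in> span_vecs X gs}"
    by (force simp: F0 n0)
  finally have aug: "{(D 0 *\<^sub>v v) $ 0 | v. v \<in> free_module X (length (sh 0))} = {v 0 | v. v \<in> span_vecs X gs}" .
  have "{D (Suc i) *\<^sub>v v | v. v \<in> free_module X (length (sh (Suc i)))}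
      = {v \<in> free_module X (length (sh i)). D i *\<^sub>v v = 0\<^sub>v (dim_row (D i))}" for i
  proof -
    have "{D (Suc i) *\<^sub>v v | v. v \<in> free_module X (length (F (Suc i)))}
        = {vec (length (F i)) c | c. c \<in> syzygies X (F i)}"
      by (simp only: D_def image_mat_span_vecs nS exact)
    moreover have "{v \<in> free_module X (length (F i)). D i *\<^sub>v v = 0\<^sub>v (n i)}
        = {vec (length (F i)) c | c. c \<in> syzygies X (F i)}"
      unfolding D_def using rank by (rule kernel_mat_syzygies)
    ultimately show ?thesis
      by (simp add: sh_def D_def)
  qed
  moreover have "graded_hom X [0] (sh 0) (D 0)"
    using entry[of _ 0] by (auto simp: graded_hom_def sh_def homogeneous_def n0) (simp add: D_def n0)
  moreover have "graded_hom X (sh i) (sh (Suc i)) (D (Suc i))" for i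
    using entry[of _ "Suc i"] by (auto simp: graded_hom_def sh_def homogeneous_def nS) (simp add: D_def nS)
  ultimately have res: "graded_free_resolution X {v 0 | v. v \<in> span_vecs X gs} sh D"
    using aug by (simp add: graded_free_resolution_def)
  \<comment> \<open>Minimality comes from linearity: an entry homogeneous of degree 1 has no
    constant term.\<close>
  have "Poly_Mapping.lookup (D (Suc i) $$ (k, l)) 0 = 0" if "k < length (F i)" "l < length (F (Suc i))" for i k l
    using entry[of k "Suc i" l] that by (force simp: homogeneous_def nS in_keys_iff)
  with res have "minimal_graded_free_resolution X {v 0 | v. v \<in> span_vecs X gs} sh D"
    by (simp add: minimal_graded_free_resolution_def sh_def)
  then show ?thesis
    unfolding linear_resolution_def by (intro exI[of _ q] exI[of _ sh] exI[of _ D]) (auto simp: sh_def)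
qed


section \<open>Monomial ideals with linear quotients\<close>

text \<open>A certificate for the colon ideal. By \<open>gt\<close>, a term of
  \<open>f * mono u\<close> divisible by some \<open>w\<close> needs a further factor from
  \<open>Y\<close>, because \<open>u\<close> has too small an exponent there; by \<open>dv\<close>,
  any variable of \<open>Y\<close> suffices as such a factor.\<close>

lemma colon_genideal_mono:
  assumes "\<And>w. w \<in> U \<Longrightarrow> Poly_Mapping.keys w \<subseteq> X" "Y \<subseteq> X" "Poly_Mapping.keys u \<subseteq> X"
    and gt: "\<And>w. w \<in> U \<Longrightarrow> \<exists>y\<in>Y. Poly_Mapping.lookup u y < Poly_Mapping.lookup w y"
    and dv: "\<And>y. y \<in> Y \<Longrightarrow> \<exists>w\<in>U. divides_exp w (u + Poly_Mapping.single y 1)"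
    and f: "f \<in> pcarrier X"
  shows "f * mono u \<in> Idl\<^bsub>poly_ring X\<^esub> (mono ` U :: ('x, 'k::field) mpoly set) \<longleftrightarrow>
    f \<in> Idl\<^bsub>poly_ring X\<^esub> (var ` Y)"
proof -
  have "(\<exists>v\<in>U. divides_exp v (w + u)) \<longleftrightarrow> (\<exists>y\<in>Y. y \<in> Poly_Mapping.keys w)" for w
  proof
    assume "\<exists>v\<in>U. divides_exp v (w + u)"
    then obtain v where v: "v \<in> U" "divides_exp v (w + u)" by blast
    then obtain y where y: "y \<in> Y" "Poly_Mapping.lookup u y < Poly_Mapping.lookup v y" using gt by blast
    have "Poly_Mapping.lookup v y \<le> Poly_Mapping.lookup w y + Poly_Mapping.lookup u y"
      using v(2) by (simp add: divides_exp_def lookup_add)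
    with y show "\<exists>y\<in>Y. y \<in> Poly_Mapping.keys w"
      by (auto simp: in_keys_iff intro!: bexI[of _ y])
  next
    assume "\<exists>y\<in>Y. y \<in> Poly_Mapping.keys w"
    then obtain y where y: "y \<in> Y" "y \<in> Poly_Mapping.keys w" by blast
    then obtain v where v: "v \<in> U" "divides_exp v (u + Poly_Mapping.single y 1)" using dv by blast
    obtain w' where "w = w' + Poly_Mapping.single y 1"
      using y(2) divides_exp_var divides_expE by metis
    then have "w + u = w' + (u + Poly_Mapping.single y 1)" by (simp add: algebra_simps)
    then show "\<exists>v\<in>U. divides_exp v (w + u)" using v divides_exp_add by metis
  qed
  then show ?thesis
    using assms(1,2) f pcarrier_mult[OF f pcarrier_mono[OF assms(3)]]
    by (simp add: genideal_mono genideal_var keys_mult_mono)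
qed

text \<open>The two clauses are the certificate of \<open>colon_genideal_mono\<close> for the
  preceding monomials; for \<open>i = 0\<close> they force \<open>Y\<close> to be empty. Minimality
  of the generators is not part of it, so it serves both for the generators of a power and for all
  monomials of one degree.\<close>

definition mono_lin_quot :: "'x set \<Rightarrow> ('x \<Rightarrow>\<^sub>0 nat) list \<Rightarrow> bool" where
  "mono_lin_quot X us \<longleftrightarrow> (\<forall>u\<in>set us. Poly_Mapping.keys u \<subseteq> X) \<and>
     (\<forall>i<length us. \<exists>Y\<subseteq>X.
        (\<forall>k<i. \<exists>y\<in>Y. Poly_Mapping.lookup (us ! i) y < Poly_Mapping.lookup (us ! k) y) \<and>
        (\<forall>y\<in>Y. \<exists>k<i. divides_exp (us ! k) (us ! i + Poly_Mapping.single y 1)))"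

lemma mono_lin_quot_colon:
  assumes "mono_lin_quot X us" "i < length us"
  obtains Y where "Y \<subseteq> X"
    "\<And>f. f \<in> pcarrier X \<Longrightarrow> f * mono (us ! i) \<in> Idl\<^bsub>poly_ring X\<^esub> (mono ` set (take i us)) \<longleftrightarrow>
      (f :: ('x, 'k::field) mpoly) \<in> Idl\<^bsub>poly_ring X\<^esub> (var ` Y)"
proof -
  from assms obtain Y where Y: "Y \<subseteq> X"
    "\<forall>k<i. \<exists>y\<in>Y. Poly_Mapping.lookup (us ! i) y < Poly_Mapping.lookup (us ! k) y"
    "\<forall>y\<in>Y. \<exists>k<i. divides_exp (us ! k) (us ! i + Poly_Mapping.single y 1)"
    unfolding mono_lin_quot_def by blast
  have keys: "\<And>u. u \<in> set us \<Longrightarrow> Poly_Mapping.keys u \<subseteq> X"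
    using assms(1) by (simp add: mono_lin_quot_def)
  have "set (take i us) = (!) us ` {..<i}"
    using nth_image[of i us] assms(2) by (simp add: atLeast0LessThan)
  moreover have "Poly_Mapping.keys w \<subseteq> X" if "w \<in> set (take i us)" for w
    using keys in_set_takeD[OF that] by blast
  ultimately show thesis
    using Y assms(2) keys[OF nth_mem[OF assms(2)]]
    by (intro that[of Y] colon_genideal_mono) auto
qed

text \<open>The antichain hypothesis yields minimality: a generator that is dropped leaves the
  ideal, since no other generator divides it.\<close>

lemma linear_quotients_mono:
  assumes lq: "mono_lin_quot X us" and "distinct us"
    and antichain: "\<And>u v. u \<in> set us \<Longrightarrow> v \<in> set us \<Longrightarrow> divides_exp u v \<Longrightarrow> u = v"
  shows "linear_quotients X (Idl\<^bsub>poly_ring X\<^esub> (mono ` set us :: ('x, 'k::field) mpoly set))"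
  unfolding linear_quotients_def
proof (intro exI[of _ "map mono us"] conjI allI impI)
  have keys: "\<And>u. u \<in> set us \<Longrightarrow> Poly_Mapping.keys u \<subseteq> X"
    using lq by (simp add: mono_lin_quot_def)
  show "distinct (map mono us :: ('x, 'k) mpoly list)"
    using assms(2) by (simp add: distinct_map inj_on_def)
  have "Idl\<^bsub>poly_ring X\<^esub> B \<noteq> Idl\<^bsub>poly_ring X\<^esub> (mono ` set us)" if B: "B \<subset> mono ` set us"
    for B :: "('x, 'k) mpoly set"
  proof
    assume eq: "Idl\<^bsub>poly_ring X\<^esub> B = Idl\<^bsub>poly_ring X\<^esub> (mono ` set us)"
    from B obtain V where V: "V \<subseteq> set us" "B = mono ` V"
      by (meson psubset_imp_subset subset_image_iff)
    with B obtain u where u: "u \<in> set us" "u \<notin> V" by blast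
    have "mono u \<in> (Idl\<^bsub>poly_ring X\<^esub> (mono ` set us) :: ('x, 'k) mpoly set)"
      using keys u(1) by (subst genideal_mono) (auto simp: mono_def pcarrier_iff intro: divides_exp_refl)
    then have "mono u \<in> (Idl\<^bsub>poly_ring X\<^esub> (mono ` V) :: ('x, 'k) mpoly set)"
      using eq V(2) by simp
    then obtain v where "v \<in> V" "divides_exp v u"
      using keys V(1) by (subst (asm) genideal_mono) (auto simp: mono_def)
    then show False using antichain u V(1) by blast
  qed
  then show "minimal_monomial_gens X (Idl\<^bsub>poly_ring X\<^esub> (mono ` set us)) (set (map mono us :: ('x, 'k) mpoly list))"
    using keys by (auto simp: minimal_monomial_gens_def monomials_def)
next
  fix i assume "1 \<le> i \<and> i < length (map mono us :: ('x, 'k) mpoly list)"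
  then have i: "i < length us" by simp
  from mono_lin_quot_colon[OF lq i, where ?'k = 'k] obtain Y where Y: "Y \<subseteq> X"
    "\<And>f. f \<in> pcarrier X \<Longrightarrow> f * mono (us ! i) \<in> Idl\<^bsub>poly_ring X\<^esub> (mono ` set (take i us)) \<longleftrightarrow>
      (f :: ('x, 'k) mpoly) \<in> Idl\<^bsub>poly_ring X\<^esub> (var ` Y)" by blast
  have "Idl\<^bsub>poly_ring X\<^esub> (var ` Y) \<subseteq> (pcarrier X :: ('x, 'k) mpoly set)"
    using genideal_var[OF Y(1)] by auto
  with Y i have "colon_ideal (poly_ring X) (Idl\<^bsub>poly_ring X\<^esub> (set (take i (map mono us)))) (map mono us ! i)
      = Idl\<^bsub>poly_ring X\<^esub> (var ` Y :: ('x, 'k) mpoly set)"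
    by (auto simp: colon_ideal_def take_map)
  with Y(1) show "\<exists>Y\<subseteq>X. colon_ideal (poly_ring X) (Idl\<^bsub>poly_ring X\<^esub> (set (take i (map mono us)))) (map mono us ! i)
      = Idl\<^bsub>poly_ring X\<^esub> (var ` Y :: ('x, 'k) mpoly set)" by blast
qed

text \<open>Passage from ideals to the module encoding: an ideal is a submodule of the free module
  of rank 1, stored in coordinate 0.\<close>

lemma span_vecs_rank1:
  fixes ps :: "('x, 'k::field) mpoly list"
  assumes "set ps \<subseteq> pcarrier X"
  shows "v \<in> span_vecs X (map (\<lambda>p r. if r = 0 then p else 0) ps) \<longleftrightarrow>
    v 0 \<in> Idl\<^bsub>poly_ring X\<^esub> (set ps) \<and> (\<forall>r\<ge>1. v r = 0)"
  using assms
proof (induction ps arbitrary: v rule: rev_induct)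
  case Nil
  have "v = (\<lambda>_. 0) \<longleftrightarrow> v 0 = 0 \<and> (\<forall>r\<ge>1. v r = 0)"
    unfolding fun_eq_iff by (metis One_nat_def Suc_leI not_gr_zero)
  then show ?case by (simp add: span_vecs_Nil genideal_poly_ring_empty)
next
  case (snoc p ps)
  then have "p \<in> pcarrier X" "set ps \<subseteq> pcarrier X" by auto
  with snoc.IH show ?case
    by (auto simp: span_vecs_snoc genideal_insert)
qed

lemma linear_resolution_mono:
  assumes "finite X" and lq: "mono_lin_quot X us" and deg: "\<And>u. u \<in> set us \<Longrightarrow> mdeg u = q"
  shows "linear_resolution X (Idl\<^bsub>poly_ring X\<^esub> (mono ` set us :: ('x, 'k::field) mpoly set))"
proof -
  define e :: "('x, 'k) mpoly \<Rightarrow> nat \<Rightarrow> ('x, 'k) mpoly" where "e = (\<lambda>p r. if r = 0 then p else 0)"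
  define gs where "gs = map e (map mono us)"
  have keys: "\<And>u. u \<in> set us \<Longrightarrow> Poly_Mapping.keys u \<subseteq> X"
    using lq by (simp add: mono_lin_quot_def)
  have "set (map mono (take i us)) \<subseteq> (pcarrier X :: ('x, 'k) mpoly set)" for i
    using keys by (auto intro!: pcarrier_mono dest: in_set_takeD)
  then have span: "v \<in> span_vecs X (map e (map mono (take i us))) \<longleftrightarrow>
      v 0 \<in> Idl\<^bsub>poly_ring X\<^esub> (mono ` set (take i us)) \<and> (\<forall>r\<ge>1. v r = 0)" for v i
    using span_vecs_rank1[of "map mono (take i us)" X v] by (simp only: e_def set_map)
  have "lin_quot X q (map e (map mono (take i us)))" if "i \<le> length us" for i
    using that
  proof (induction i)
    case 0
    then show ?case by (simp add: lin_quot.Nil)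
  next
    case (Suc i)
    then have i: "i < length us" and IH: "lin_quot X q (map e (map mono (take i us)))" by auto
    from mono_lin_quot_colon[OF lq i, where ?'k = 'k] obtain Y where Y: "Y \<subseteq> X"
      "\<And>f. f \<in> pcarrier X \<Longrightarrow> f * mono (us ! i) \<in> Idl\<^bsub>poly_ring X\<^esub> (mono ` set (take i us)) \<longleftrightarrow>
        (f :: ('x, 'k) mpoly) \<in> Idl\<^bsub>poly_ring X\<^esub> (var ` Y)" by blast
    have "lin_quot X q (map e (map mono (take i us)) @ [e (mono (us ! i))])"
    proof (rule lin_quot.snoc[OF IH Y(1)])
      show "e (mono (us ! i)) r \<in> pcarrier X" for r
        using keys[OF nth_mem[OF i]] by (simp add: e_def pcarrier_mono pcarrier_zero)
      show "homogeneous q (e (mono (us ! i)) r)" for r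
        using deg[OF nth_mem[OF i]] homogeneous_mono[of "us ! i"] by (auto simp: e_def homogeneous_zero)
      fix f :: "('x, 'k) mpoly" assume f: "f \<in> pcarrier X"
      show "(\<lambda>r. f * e (mono (us ! i)) r) \<in> span_vecs X (map e (map mono (take i us))) \<longleftrightarrow>
          f \<in> Idl\<^bsub>poly_ring X\<^esub> (var ` Y)"
        unfolding span using Y(2)[OF f] by (simp add: e_def)
    qed
    then show ?case using i by (simp add: take_Suc_conv_app_nth)
  qed
  from this[of "length us"] have "lin_quot X q gs" by (simp add: gs_def)
  then have "linear_resolution X {v 0 | v. v \<in> span_vecs X gs}"
    by (intro linear_resolution_of_lin_quot[OF assms(1)]) (auto simp: gs_def e_def)
  moreover have "{v 0 | v. v \<in> span_vecs X gs} = Idl\<^bsub>poly_ring X\<^esub> (mono ` set us :: ('x, 'k) mpoly set)"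
  proof (intro equalityI subsetI)
    fix p :: "('x, 'k) mpoly" assume "p \<in> Idl\<^bsub>poly_ring X\<^esub> (mono ` set us)"
    then have "e p \<in> span_vecs X gs" "e p 0 = p"
      using span[of "e p" "length us"] by (auto simp: gs_def e_def)
    then show "p \<in> {v 0 | v. v \<in> span_vecs X gs}"
      by (intro CollectI exI[of _ "e p"]) simp
  qed (use span[of _ "length us"] in \<open>auto simp: gs_def\<close>)
  ultimately show ?thesis by simp
qed

text \<open>The terms of a degree \<open>j\<close> element of a monomial ideal are monomials of
  degree \<open>j\<close> in it, so these monomials generate the component. They share one degree,
  so linear quotients give a linear resolution.\<close>

lemma componentwise_linear_mono:
  assumes "finite X" and U: "\<And>u. u \<in> U \<Longrightarrow> Poly_Mapping.keys u \<subseteq> X"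
    and comp: "\<And>j. \<exists>us. mono_lin_quot X us \<and>
      set us = {w. Poly_Mapping.keys w \<subseteq> X \<and> mdeg w = j \<and> (\<exists>u\<in>U. divides_exp u w)}"
  shows "componentwise_linear X (Idl\<^bsub>poly_ring X\<^esub> (mono ` U :: ('x, 'k::field) mpoly set))"
proof -
  interpret cring "poly_ring X :: ('x, 'k) mpoly ring" by (rule cring_poly_ring)
  let ?I = "Idl\<^bsub>poly_ring X\<^esub> (mono ` U :: ('x, 'k) mpoly set)"
  have sub: "(mono ` U :: ('x, 'k) mpoly set) \<subseteq> pcarrier X"
    using U by (auto intro: pcarrier_mono)
  have I: "ideal ?I (poly_ring X)"
    by (rule genideal_ideal[OF sub])
  have mem: "p \<in> ?I \<longleftrightarrow> p \<in> pcarrier X \<and> (\<forall>w\<in>Poly_Mapping.keys p. \<exists>u\<in>U. divides_exp u w)" for p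
    using U by (simp add: genideal_mono)
  have "graded_ideal X ?I"
    unfolding graded_ideal_def
  proof (intro conjI I equalityI)
    let ?A = "{p \<in> ?I. \<exists>j. homogeneous j p}"
    have A: "?A \<subseteq> pcarrier X" using mem by blast
    have "mono ` U \<subseteq> ?A"
      using genideal_self[OF sub] homogeneous_mono by blast
    then have "mono ` U \<subseteq> Idl\<^bsub>poly_ring X\<^esub> ?A"
      using genideal_self[OF A] by blast
    then show "?I \<subseteq> Idl\<^bsub>poly_ring X\<^esub> ?A"
      by (rule genideal_minimal[OF genideal_ideal[OF A]])
    show "Idl\<^bsub>poly_ring X\<^esub> ?A \<subseteq> ?I"
      by (rule genideal_minimal[OF I]) blast
  qed
  moreover have "linear_resolution X (Idl\<^bsub>poly_ring X\<^esub> {p \<in> ?I. homogeneous j p})" for j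
  proof -
    obtain us where lq: "mono_lin_quot X us"
      and us: "set us = {w. Poly_Mapping.keys w \<subseteq> X \<and> mdeg w = j \<and> (\<exists>u\<in>U. divides_exp u w)}"
      using comp by blast
    let ?J = "Idl\<^bsub>poly_ring X\<^esub> (mono ` set us :: ('x, 'k) mpoly set)"
    let ?A = "{p \<in> ?I. homogeneous j p}"
    have sub': "(mono ` set us :: ('x, 'k) mpoly set) \<subseteq> pcarrier X"
      using us by (auto intro: pcarrier_mono)
    have A: "?A \<subseteq> pcarrier X" using mem by blast
    have memJ: "p \<in> ?J \<longleftrightarrow> p \<in> pcarrier X \<and> (\<forall>w\<in>Poly_Mapping.keys p. \<exists>u\<in>set us. divides_exp u w)" for p
      using us by (subst genideal_mono) auto
    have "?A \<subseteq> ?J"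
    proof
      fix p assume p: "p \<in> ?A"
      have "w \<in> set us" if "w \<in> Poly_Mapping.keys p" for w
        using p that mem[of p] us by (auto simp: homogeneous_def pcarrier_iff)
      then show "p \<in> ?J"
        using p mem[of p] memJ[of p] divides_exp_refl by auto
    qed
    then have "Idl\<^bsub>poly_ring X\<^esub> ?A \<subseteq> ?J"
      by (rule genideal_minimal[OF genideal_ideal[OF sub']])
    moreover have "mono ` set us \<subseteq> ?A"
      using us homogeneous_mono mem by (fastforce intro: pcarrier_mono simp: mono_def)
    then have "mono ` set us \<subseteq> Idl\<^bsub>poly_ring X\<^esub> ?A"
      using genideal_self[OF A] by blast
    then have "?J \<subseteq> Idl\<^bsub>poly_ring X\<^esub> ?A"
      by (rule genideal_minimal[OF genideal_ideal[OF A]])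
    ultimately have "Idl\<^bsub>poly_ring X\<^esub> ?A = ?J" by blast
    moreover have "linear_resolution X ?J"
      using us by (intro linear_resolution_mono[OF assms(1) lq]) auto
    ultimately show ?thesis by simp
  qed
  ultimately show ?thesis by (simp add: componentwise_linear_def)
qed

lemma ideal_prod_mono:
  assumes U: "\<And>u. u \<in> U \<Longrightarrow> Poly_Mapping.keys u \<subseteq> X" and V: "\<And>v. v \<in> V \<Longrightarrow> Poly_Mapping.keys v \<subseteq> X"
  shows "ideal_prod (poly_ring X) (Idl\<^bsub>poly_ring X\<^esub> (mono ` U)) (Idl\<^bsub>poly_ring X\<^esub> (mono ` V))
    = Idl\<^bsub>poly_ring X\<^esub> (mono ` {u + v | u v. u \<in> U \<and> v \<in> V} :: ('x, 'k::field) mpoly set)"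
    (is "ideal_prod _ ?I ?J = ?K")
proof
  interpret cring "poly_ring X :: ('x, 'k) mpoly ring" by (rule cring_poly_ring)
  have UV: "Poly_Mapping.keys w \<subseteq> X" if w: "w \<in> {u + v | u v. u \<in> U \<and> v \<in> V}" for w
  proof -
    obtain u v where "w = u + v" "u \<in> U" "v \<in> V" using w by blast
    then show ?thesis using U V by (simp add: keys_add_nat)
  qed
  have sub: "(mono ` U :: ('x, 'k) mpoly set) \<subseteq> pcarrier X" "(mono ` V :: ('x, 'k) mpoly set) \<subseteq> pcarrier X"
    using U V by (auto intro!: pcarrier_mono)
  have sub': "(mono ` {u + v | u v. u \<in> U \<and> v \<in> V} :: ('x, 'k) mpoly set) \<subseteq> pcarrier X"
    by (intro image_subsetI pcarrier_mono UV)
  have I: "ideal ?I (poly_ring X)" and J: "ideal ?J (poly_ring X)" and K: "ideal ?K (poly_ring X)"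
    by (rule genideal_ideal[OF sub(1)], rule genideal_ideal[OF sub(2)], rule genideal_ideal[OF sub'])
  show "ideal_prod (poly_ring X) ?I ?J \<subseteq> ?K"
  proof
    fix p assume "p \<in> ideal_prod (poly_ring X) ?I ?J"
    then show "p \<in> ?K"
    proof (induction rule: ideal_prod.induct)
      case (prod f g)
      have f: "f \<in> pcarrier X" "\<forall>w\<in>Poly_Mapping.keys f. \<exists>u\<in>U. divides_exp u w"
        using prod(1) U by (simp_all add: genideal_mono)
      have g: "g \<in> pcarrier X" "\<forall>w\<in>Poly_Mapping.keys g. \<exists>u\<in>V. divides_exp u w"
        using prod(2) V by (simp_all add: genideal_mono)
      have "\<exists>x\<in>{u + v | u v. u \<in> U \<and> v \<in> V}. divides_exp x w" if w: "w \<in> Poly_Mapping.keys (f * g)" for w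
      proof -
        obtain a b where ab: "w = a + b" "a \<in> Poly_Mapping.keys f" "b \<in> Poly_Mapping.keys g"
          using w keys_mult[of f g] by blast
        then obtain u v where "u \<in> U" "v \<in> V" "divides_exp u a" "divides_exp v b"
          using f g by blast
        with ab show ?thesis
          by (intro bexI[of _ "u + v"]) (auto simp: divides_exp_def lookup_add add_mono)
      qed
      then show ?case
        using UV pcarrier_mult[OF f(1) g(1)] by (simp only: genideal_mono poly_ring_simps) blast
    next
      case (sum p q)
      then show ?case using ideal_poly_ringD(2)[OF K] by simp
    qed
  qed
  have "mono ` {u + v | u v. u \<in> U \<and> v \<in> V} \<subseteq> ideal_prod (poly_ring X) ?I ?J"
  proof
    fix p :: "('x, 'k) mpoly" assume "p \<in> mono ` {u + v | u v. u \<in> U \<and> v \<in> V}"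
    then obtain u v where uv: "u \<in> U" "v \<in> V" "p = mono u * mono v"
      by (auto simp: mult_mono)
    moreover have "mono u \<in> ?I" "mono v \<in> ?J"
      using uv genideal_self sub by blast+
    ultimately show "p \<in> ideal_prod (poly_ring X) ?I ?J"
      using ideal_prod.prod[of "mono u" ?I "mono v" ?J "poly_ring X"] by simp
  qed
  then show "?K \<subseteq> ideal_prod (poly_ring X) ?I ?J"
    by (rule genideal_minimal[OF ideal_prod_is_ideal[OF I J]])
qed


section \<open>Monomials attached to a down-closed set of exponent functions\<close>

lemma exists_list_sorted_by_key:
  fixes key :: "'a \<Rightarrow> 'b::linorder"
  assumes "finite A"
  obtains xs where "distinct xs" "set xs = A"
    "\<And>i k. i < k \<Longrightarrow> k < length xs \<Longrightarrow> key (xs ! i) \<le> key (xs ! k)"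
proof -
  obtain ys where ys: "distinct ys" "set ys = A"
    using finite_distinct_list[OF assms] by blast
  have "sorted (map key (sort_key key ys))" by simp
  then have "key (sort_key key ys ! i) \<le> key (sort_key key ys ! k)"
    if "i < k" "k < length (sort_key key ys)" for i k
    using that sorted_nth_mono[of "map key (sort_key key ys)" i k] by simp
  with ys show thesis by (intro that[of "sort_key key ys"]) auto
qed

lemma finite_exponents:
  assumes "finite X"
  shows "finite {w :: 'x \<Rightarrow>\<^sub>0 nat. Poly_Mapping.keys w \<subseteq> X \<and> mdeg w = j}"
proof -
  have "Poly_Mapping.lookup w x \<le> mdeg w" if "Poly_Mapping.keys w \<subseteq> X" "x \<in> X" for w :: "'x \<Rightarrow>\<^sub>0 nat" and x
    using that assms by (simp add: mdeg_eq_sum member_le_sum)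
  then have "Poly_Mapping.lookup ` {w :: 'x \<Rightarrow>\<^sub>0 nat. Poly_Mapping.keys w \<subseteq> X \<and> mdeg w = j}
      \<subseteq> {f. \<forall>x. (x \<in> X \<longrightarrow> f x \<in> {..j}) \<and> (x \<notin> X \<longrightarrow> f x = 0)}"
    by (auto simp: in_keys_iff)
  then have "finite (Poly_Mapping.lookup ` {w :: 'x \<Rightarrow>\<^sub>0 nat. Poly_Mapping.keys w \<subseteq> X \<and> mdeg w = j})"
    using finite_set_of_finite_funs[OF assms, of "{..j}" 0] finite_subset by blast
  then show ?thesis
    by (rule finite_imageD) (simp add: inj_on_def lookup_inject)
qed

lemma sum_decrement:
  assumes "finite A" "x \<in> A" "0 < a x"
  shows "(\<Sum>y\<in>A. (a(x := a x - 1)) y) + 1 = (\<Sum>y\<in>A. a y :: nat)"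
  using assms by (simp add: sum.remove[of A x])

text \<open>\<open>B\<close> is the set of base variables, \<open>N z\<close> the set of base variables adjacent to the whisker
  \<open>z\<close>, and \<open>w a\<close> the exponent of the monomial attached to \<open>a\<close>.\<close>

locale whisker_monomials =
  fixes X B :: "'x set" and N :: "'x \<Rightarrow> 'x set" and M :: "('x \<Rightarrow> nat) set" and t :: nat
    and w :: "('x \<Rightarrow> nat) \<Rightarrow> 'x \<Rightarrow>\<^sub>0 nat"
  assumes fin: "finite X" and B: "B \<subseteq> X"
    and N: "z \<in> X - B \<Longrightarrow> N z \<subseteq> B"
    and whisker: "x \<in> B \<Longrightarrow> \<exists>z\<in>X - B. x \<in> N z"
    and supp: "a \<in> M \<Longrightarrow> x \<notin> B \<Longrightarrow> a x = 0"
    and bound: "a \<in> M \<Longrightarrow> a x \<le> t"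
    and down: "a \<in> M \<Longrightarrow> (\<And>x. b x \<le> a x) \<Longrightarrow> b \<in> M"
    and lookup_w: "a \<in> M \<Longrightarrow> Poly_Mapping.lookup (w a) x =
      (if x \<in> B then t - a x else if x \<in> X then \<Sum>y\<in>N x. a y else 0)"
begin

lemma fin_B: "finite B"
  using fin B finite_subset by blast

lemma fin_N: "z \<in> X - B \<Longrightarrow> finite (N z)"
  using fin_B N finite_subset by blast

lemma finite_M: "finite M"
proof -
  have "M \<subseteq> {f. \<forall>x. (x \<in> B \<longrightarrow> f x \<in> {..t}) \<and> (x \<notin> B \<longrightarrow> f x = 0)}"
    using supp bound by auto
  then show ?thesis
    using finite_set_of_finite_funs[OF fin_B, of "{..t}" 0] finite_subset by blast
qed

lemma keys_w: "a \<in> M \<Longrightarrow> Poly_Mapping.keys (w a) \<subseteq> X"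
  using B by (auto simp: in_keys_iff lookup_w split: if_splits)

lemma decrement_M: "a \<in> M \<Longrightarrow> a(x := a x - 1) \<in> M"
  by (erule down) simp

lemma eq_of_le_sum:
  assumes le: "\<And>x. x \<in> B \<Longrightarrow> a x \<le> b x" and sum: "(\<Sum>x\<in>B. b x) \<le> (\<Sum>x\<in>B. a x :: nat)"
  shows "x \<in> B \<Longrightarrow> a x = b x"
  using sum_strict_mono_ex1[OF fin_B, of a b] le sum by (metis le_neq_implies_less leD)

text \<open>Divisibility of the base parts puts \<open>b\<close> below \<open>a\<close> pointwise;
  divisibility at a whisker gives the opposite inequality for the sums over \<open>N z\<close>.
  Every base variable lies in some \<open>N z\<close>, so equality follows.\<close>

lemma divides_w_imp_eq:
  assumes "a \<in> M" "b \<in> M" "divides_exp (w a) (w b)"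
  shows "a = b"
proof
  fix x
  have le: "b y \<le> a y" for y
  proof (cases "y \<in> B")
    case True
    then have "t - a y \<le> t - b y"
      using assms by (metis divides_exp_def lookup_w)
    then show ?thesis using bound[OF assms(2), of y] bound[OF assms(1), of y] by simp
  next
    case False
    then show ?thesis using supp[OF assms(2)] by simp
  qed
  show "a x = b x"
  proof (cases "x \<in> B")
    case True
    then obtain z where z: "z \<in> X - B" "x \<in> N z" using whisker by blast
    have "(\<Sum>y\<in>N z. a y) \<le> (\<Sum>y\<in>N z. b y)"
      using assms z(1) by (metis DiffE divides_exp_def lookup_w)
    then show ?thesis
      using sum_strict_mono_ex1[OF fin_N[OF z(1)], of b a] le z(2) by (metis le_neq_implies_less leD)
  next
    case False
    then show ?thesis using supp[OF assms(1)] supp[OF assms(2)] by simp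
  qed
qed

lemma inj_w: "inj_on w M"
  by (rule inj_onI) (metis divides_w_imp_eq divides_exp_refl)

text \<open>Ordered by \<open>\<Sum>x\<in>B. a x\<close>, the colon ideal at \<open>w a\<close> is generated by the support of \<open>a\<close>:
  lowering \<open>a\<close> by one at \<open>x\<close> multiplies the base part of the monomial by \<open>x\<close> and divides the
  whisker part.\<close>

lemma linear_quotients_w:
  "linear_quotients X (Idl\<^bsub>poly_ring X\<^esub> (mono ` w ` M :: ('x, 'k::field) mpoly set))"
proof -
  obtain as where as: "distinct as" "set as = M"
    and sorted: "\<And>i k. i < k \<Longrightarrow> k < length as \<Longrightarrow> (\<Sum>x\<in>B. (as ! i) x) \<le> (\<Sum>x\<in>B. (as ! k) x)"
    using exists_list_sorted_by_key[OF finite_M, of "\<lambda>a. \<Sum>x\<in>B. a x"] by blast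
  have "mono_lin_quot X (map w as)"
    unfolding mono_lin_quot_def length_map
  proof (intro conjI ballI allI impI)
    fix u assume "u \<in> set (map w as)"
    then show "Poly_Mapping.keys u \<subseteq> X" using as(2) keys_w by auto
  next
    fix i assume i: "i < length as"
    define a where "a = as ! i"
    have a: "a \<in> M" using i as(2) by (auto simp: a_def)
    have gt: "\<exists>y\<in>{x \<in> B. 0 < a x}. Poly_Mapping.lookup (map w as ! i) y < Poly_Mapping.lookup (map w as ! k) y"
      if k: "k < i" for k
    proof -
      define b where "b = as ! k"
      have b: "b \<in> M" using k i as(2) by (auto simp: b_def)
      have "a \<noteq> b" using k i as(1) by (simp add: a_def b_def nth_eq_iff_index_eq)
      \<comment> \<open>If \<open>a\<close> were at most \<open>b\<close> throughout, the order by
        total size would force equality. Where \<open>b x < a x\<close>, the base exponent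
        \<open>t - a x\<close> is strictly the smaller one because \<open>a x\<close> is at most
        \<open>t\<close>.\<close>
      have "\<exists>x\<in>B. b x < a x"
      proof (rule ccontr)
        assume "\<not> (\<exists>x\<in>B. b x < a x)"
        then have "a x = b x" if "x \<in> B" for x
          using that sorted[OF k i] by (intro eq_of_le_sum) (auto simp: a_def b_def not_less)
        then have "a = b" using supp[OF a] supp[OF b] by (intro ext) metis
        with \<open>a \<noteq> b\<close> show False ..
      qed
      then obtain x where x: "x \<in> B" "b x < a x" by blast
      then show ?thesis
        using k i bound[OF a, of x] a b by (intro bexI[of _ x]) (auto simp: lookup_w a_def b_def)
    qed
    have dv: "\<exists>k<i. divides_exp (map w as ! k) (map w as ! i + Poly_Mapping.single y 1)"
      if y: "y \<in> {x \<in> B. 0 < a x}" for y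
    proof -
      define c where "c = a(y := a y - 1)"
      have c: "c \<in> M" using decrement_M[OF a] by (simp add: c_def)
      then obtain k where k: "k < length as" "as ! k = c"
        using as(2) by (metis in_set_conv_nth)
      have "(\<Sum>x\<in>B. c x) + 1 = (\<Sum>x\<in>B. a x)"
        unfolding c_def using y fin_B by (intro sum_decrement) auto
      then have "\<not> i \<le> k"
        using sorted[of i k] k by (cases "i = k") (auto simp: a_def)
      moreover have "divides_exp (w c) (w a + Poly_Mapping.single y 1)"
        unfolding divides_exp_def lookup_add
      proof
        fix x
        have "(\<Sum>y\<in>N x. c y) \<le> (\<Sum>y\<in>N x. a y)"
          by (rule sum_mono) (simp add: c_def)
        then show "Poly_Mapping.lookup (w c) x
            \<le> Poly_Mapping.lookup (w a) x + Poly_Mapping.lookup (Poly_Mapping.single y 1) x"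
          using a c by (auto simp: lookup_w lookup_single c_def when_def)
      qed
      ultimately show ?thesis
        using k i by (intro exI[of _ k]) (auto simp: a_def)
    qed
    show "\<exists>Y\<subseteq>X. (\<forall>k<i. \<exists>y\<in>Y. Poly_Mapping.lookup (map w as ! i) y < Poly_Mapping.lookup (map w as ! k) y) \<and>
        (\<forall>y\<in>Y. \<exists>k<i. divides_exp (map w as ! k) (map w as ! i + Poly_Mapping.single y 1))"
      using gt dv B by (intro exI[of _ "{x \<in> B. 0 < a x}"]) blast
  qed
  moreover have "distinct (map w as)"
    using as inj_w by (simp add: distinct_map)
  ultimately have "linear_quotients X (Idl\<^bsub>poly_ring X\<^esub> (mono ` set (map w as) :: ('x, 'k) mpoly set))"
    using as(2) divides_w_imp_eq by (intro linear_quotients_mono) auto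
  then show ?thesis using as(2) by simp
qed

section \<open>Monomials of a fixed degree and exchanges between them\<close>

definition deficit :: "('x \<Rightarrow>\<^sub>0 nat) \<Rightarrow> 'x \<Rightarrow> nat" where
  "deficit v x = (if x \<in> B then t - Poly_Mapping.lookup v x else 0)"

text \<open>\<open>deficit v\<close> is the least \<open>a\<close> for which the base part of \<open>w a\<close> divides \<open>v\<close>.\<close>

lemma divides_w_iff:
  "(\<exists>a\<in>M. divides_exp (w a) v) \<longleftrightarrow>
    deficit v \<in> M \<and> (\<forall>z\<in>X - B. (\<Sum>y\<in>N z. deficit v y) \<le> Poly_Mapping.lookup v z)"
proof
  assume "\<exists>a\<in>M. divides_exp (w a) v"
  then obtain a where a: "a \<in> M" "divides_exp (w a) v" by blast
  have le: "deficit v x \<le> a x" for x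
  proof (cases "x \<in> B")
    case True
    then have "t - a x \<le> Poly_Mapping.lookup v x"
      using a by (metis divides_exp_def lookup_w)
    then show ?thesis using True by (simp add: deficit_def)
  qed (simp add: deficit_def)
  have "(\<Sum>y\<in>N z. deficit v y) \<le> Poly_Mapping.lookup v z" if "z \<in> X - B" for z
  proof -
    have "(\<Sum>y\<in>N z. deficit v y) \<le> (\<Sum>y\<in>N z. a y)"
      by (rule sum_mono) (rule le)
    also have "\<dots> \<le> Poly_Mapping.lookup v z"
      using a that by (metis DiffE divides_exp_def lookup_w)
    finally show ?thesis .
  qed
  with down[OF a(1) le] show "deficit v \<in> M \<and> (\<forall>z\<in>X - B. (\<Sum>y\<in>N z. deficit v y) \<le> Poly_Mapping.lookup v z)"
    by blast
next
  assume *: "deficit v \<in> M \<and> (\<forall>z\<in>X - B. (\<Sum>y\<in>N z. deficit v y) \<le> Poly_Mapping.lookup v z)"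
  then have "divides_exp (w (deficit v)) v"
    unfolding divides_exp_def by (auto simp: lookup_w) (simp add: deficit_def)
  with * show "\<exists>a\<in>M. divides_exp (w a) v" by blast
qed

definition component :: "nat \<Rightarrow> ('x \<Rightarrow>\<^sub>0 nat) set" where
  "component j = {v. Poly_Mapping.keys v \<subseteq> X \<and> mdeg v = j \<and> (\<exists>u\<in>w ` M. divides_exp u v)}"

lemma component_iff:
  "v \<in> component j \<longleftrightarrow> Poly_Mapping.keys v \<subseteq> X \<and> mdeg v = j \<and> deficit v \<in> M \<and>
    (\<forall>z\<in>X - B. (\<Sum>y\<in>N z. deficit v y) \<le> Poly_Mapping.lookup v z)"
  unfolding component_def using divides_w_iff by auto

lemma lookup_component:
  assumes "u \<in> component j"
  shows "Poly_Mapping.lookup u x \<le> j" "x \<notin> X \<Longrightarrow> Poly_Mapping.lookup u x = 0"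
proof -
  show 0: "x \<notin> X \<Longrightarrow> Poly_Mapping.lookup u x = 0"
    using assms by (auto simp: component_iff in_keys_iff)
  show "Poly_Mapping.lookup u x \<le> j"
    using assms fin 0 by (cases "x \<in> X") (auto simp: component_iff mdeg_eq_sum intro: member_le_sum)
qed

lemma finite_component: "finite (component j)"
  using finite_exponents[OF fin, of j] by (rule rev_finite_subset) (auto simp: component_def)

text \<open>When \<open>y'\<close> divides \<open>v\<close> the degree is kept, and the result
  divides \<open>y\<close> times \<open>v\<close>. An exchange within the component that precedes
  \<open>v\<close> therefore certifies that \<open>y\<close> lies in the colon ideal at
  \<open>v\<close>.\<close>

definition exchange :: "('x \<Rightarrow>\<^sub>0 nat) \<Rightarrow> 'x \<Rightarrow> 'x \<Rightarrow> 'x \<Rightarrow>\<^sub>0 nat" where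
  "exchange v y y' = v + Poly_Mapping.single y 1 - Poly_Mapping.single y' 1"

lemma lookup_exchange:
  "y \<noteq> y' \<Longrightarrow> Poly_Mapping.lookup (exchange v y y') x =
    (if x = y then Poly_Mapping.lookup v x + 1 else if x = y' then Poly_Mapping.lookup v x - 1
     else Poly_Mapping.lookup v x)"
  by (simp add: exchange_def lookup_add lookup_minus lookup_single when_def)

lemma keys_mdeg_exchange:
  assumes "Poly_Mapping.keys v \<subseteq> X" "y \<in> X" "y \<noteq> y'" "0 < Poly_Mapping.lookup v y'"
  shows "Poly_Mapping.keys (exchange v y y') \<subseteq> X" "mdeg (exchange v y y') = mdeg v"
proof -
  show "Poly_Mapping.keys (exchange v y y') \<subseteq> X"
    using assms by (fastforce simp: in_keys_iff lookup_exchange split: if_splits)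
  have "exchange v y y' + Poly_Mapping.single y' 1 = v + Poly_Mapping.single y 1"
    using assms(3,4)
    by (intro poly_mapping_eqI) (auto simp: lookup_add lookup_exchange lookup_single when_def)
  then have "mdeg (exchange v y y' + Poly_Mapping.single y' 1) = mdeg (v + Poly_Mapping.single y 1)"
    by (rule arg_cong)
  then show "mdeg (exchange v y y') = mdeg v"
    by (simp add: mdeg_add)
qed

lemma divides_exchange: "y \<noteq> y' \<Longrightarrow> divides_exp (exchange v y y') (v + Poly_Mapping.single y 1)"
  by (auto simp: divides_exp_def lookup_exchange lookup_add lookup_single when_def)

text \<open>Monomials of degree \<open>j\<close> are ordered first by the total deficit and then
  lexicographically; the entry \<open>j - lookup v x\<close> reverses the order of the exponents.\<close>

definition key :: "nat \<Rightarrow> 'x list \<Rightarrow> ('x \<Rightarrow>\<^sub>0 nat) \<Rightarrow> nat list" where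
  "key j xs v = (\<Sum>x\<in>B. deficit v x) # map (\<lambda>x. j - Poly_Mapping.lookup v x) xs"

text \<open>Raising \<open>x\<close> is paid for by a whisker \<open>z\<close> adjacent to it. The
  deficit at \<open>x\<close> drops by one, so the sum over \<open>N z\<close> drops together with
  the exponent of \<open>z\<close>; at other whiskers the exponent is unchanged and the sum does not
  grow.\<close>

lemma exchange_smaller_deficit:
  assumes v: "v \<in> component j" and x: "x \<in> B" "0 < deficit v x"
  obtains z where "z \<noteq> x" "exchange v x z \<in> component j" "key j xs (exchange v x z) < key j xs v"
proof -
  obtain z where z: "z \<in> X - B" "x \<in> N z" using whisker[OF x(1)] by blast
  have ne: "x \<noteq> z" using x z by blast
  have def_eq: "deficit (exchange v x z) = (deficit v)(x := deficit v x - 1)"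
    using x z ne by (auto simp: fun_eq_iff deficit_def lookup_exchange)
  have dec: "(\<Sum>y\<in>A. deficit (exchange v x z) y) + 1 = (\<Sum>y\<in>A. deficit v y)" if "finite A" "x \<in> A" for A
    unfolding def_eq using that x by (intro sum_decrement) auto
  have mono: "(\<Sum>y\<in>A. deficit (exchange v x z) y) \<le> (\<Sum>y\<in>A. deficit v y)" for A
    unfolding def_eq by (rule sum_mono) simp
  have vz: "(\<Sum>y\<in>N z'. deficit v y) \<le> Poly_Mapping.lookup v z'" if "z' \<in> X - B" for z'
    using v that by (simp add: component_iff)
  \<comment> \<open>The deficit sum over \<open>N z\<close> is at least 1 because of
    \<open>x\<close>, and it is a lower bound for the exponent of \<open>z\<close>.\<close>
  have pos: "0 < Poly_Mapping.lookup v z"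
    using dec[OF fin_N[OF z(1)] z(2)] vz[OF z(1)] by linarith
  have "(\<Sum>y\<in>N z'. deficit (exchange v x z) y) \<le> Poly_Mapping.lookup (exchange v x z) z'" if z': "z' \<in> X - B" for z'
  proof (cases "z' = z")
    case True
    then show ?thesis
      using dec[OF fin_N[OF z(1)] z(2)] vz[OF z(1)] ne by (simp add: lookup_exchange)
  next
    case False
    moreover have "z' \<noteq> x" using z' x by blast
    ultimately show ?thesis
      using mono[of "N z'"] vz[OF z'] ne by (simp add: lookup_exchange)
  qed
  then have "exchange v x z \<in> component j"
    using v decrement_M[of "deficit v" x] keys_mdeg_exchange[OF _ _ ne pos] x(1) B
    by (auto simp: component_iff def_eq)
  moreover have "key j xs (exchange v x z) < key j xs v"
    using dec[OF fin_B x(1)] by (simp add: key_def)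
  ultimately show thesis using that[of z] ne by blast
qed

text \<open>At the first coordinate \<open>y\<close> where the keys differ, \<open>v\<close> has the
  smaller exponent; the degrees being equal, some \<open>y'\<close> has the larger one. The exchange
  moves \<open>v\<close> towards \<open>p\<close> without overshooting, so lower bounds satisfied by
  both persist.\<close>

lemma exchange_same_deficit:
  assumes v: "v \<in> component j" and p: "p \<in> component j" and eq: "deficit p = deficit v"
    and xs: "set xs = X" "distinct xs" and less: "key j xs p < key j xs v"
  obtains y y' where "y \<in> X" "Poly_Mapping.lookup v y < Poly_Mapping.lookup p y" "y \<noteq> y'"
    "exchange v y y' \<in> component j" "key j xs (exchange v y y') < key j xs v"
proof -
  let ?l = "\<lambda>v. map (\<lambda>x. j - Poly_Mapping.lookup v x) xs"
  have "(?l p, ?l v) \<in> lexord {(u, v). u < v}"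
    using less by (simp add: key_def eq list_less_def)
  then obtain n where n: "n < length xs" "take n (?l p) = take n (?l v)" "?l p ! n < ?l v ! n"
    by (auto simp: lexord_take_index_conv)
  define y where "y = xs ! n"
  have y: "y \<in> X" "Poly_Mapping.lookup v y < Poly_Mapping.lookup p y"
    using n(1,3) xs(1) by (auto simp: y_def)
  have before: "Poly_Mapping.lookup p (xs ! i) = Poly_Mapping.lookup v (xs ! i)" if "i < n" for i
  proof -
    have "take n (?l p) ! i = take n (?l v) ! i" using n(2) by simp
    then have "j - Poly_Mapping.lookup p (xs ! i) = j - Poly_Mapping.lookup v (xs ! i)"
      using that n(1) by simp
    then show ?thesis using lookup_component(1)[OF p] lookup_component(1)[OF v] by (metis diff_diff_cancel)
  qed
  have "\<exists>y'\<in>X. Poly_Mapping.lookup p y' < Poly_Mapping.lookup v y'"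
  proof (rule ccontr)
    assume "\<not> ?thesis"
    then have "(\<Sum>x\<in>X. Poly_Mapping.lookup v x) < (\<Sum>x\<in>X. Poly_Mapping.lookup p x)"
      using y fin by (intro sum_strict_mono_ex1) (auto simp: not_less)
    moreover have "(\<Sum>x\<in>X. Poly_Mapping.lookup u x) = j" if "u \<in> component j" for u
      using that mdeg_eq_sum[OF fin, of u] by (simp add: component_iff)
    ultimately show False
      using v p by simp
  qed
  then obtain y' where y': "y' \<in> X" "Poly_Mapping.lookup p y' < Poly_Mapping.lookup v y'" by blast
  have ne: "y \<noteq> y'" using y(2) y'(2) by auto
  \<comment> \<open>At a base variable, equal deficits with different exponents mean that both
    exponents are at least \<open>t\<close>. So neither raising \<open>y\<close> nor lowering
    \<open>y'\<close> changes the deficit.\<close>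
  have def_eq: "deficit (exchange v y y') = deficit v"
  proof
    fix x
    have "t - Poly_Mapping.lookup p x = t - Poly_Mapping.lookup v x" if "x \<in> B"
      using that fun_cong[OF eq, of x] by (simp add: deficit_def)
    then show "deficit (exchange v y y') x = deficit v x"
      using y(2) y'(2) ne by (auto simp: deficit_def lookup_exchange)
  qed
  have "(\<Sum>x\<in>N z. deficit v x) \<le> Poly_Mapping.lookup (exchange v y y') z" if z: "z \<in> X - B" for z
  proof -
    have "(\<Sum>x\<in>N z. deficit v x) \<le> Poly_Mapping.lookup v z" "(\<Sum>x\<in>N z. deficit v x) \<le> Poly_Mapping.lookup p z"
      using v p z eq by (auto simp: component_iff)
    then show ?thesis
      using y'(2) ne by (auto simp: lookup_exchange)
  qed
  then have comp: "exchange v y y' \<in> component j"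
    using v keys_mdeg_exchange[OF _ y(1) ne] y'(2) by (auto simp: component_iff def_eq)
  have "take n (?l (exchange v y y')) = take n (?l v)"
  proof (rule nth_equalityI)
    fix i assume "i < length (take n (?l (exchange v y y')))"
    then have i: "i < n" by simp
    \<comment> \<open>\<open>y'\<close> cannot precede \<open>y\<close> in \<open>xs\<close>,
      because \<open>p\<close> and \<open>v\<close> agree on the earlier coordinates.\<close>
    then have "xs ! i \<noteq> y" "xs ! i \<noteq> y'"
      using n(1) xs(2) before[OF i] y'(2) by (auto simp: y_def nth_eq_iff_index_eq)
    then show "take n (?l (exchange v y y')) ! i = take n (?l v) ! i"
      using i n(1) ne by (simp add: lookup_exchange)
  qed simp
  moreover have "?l (exchange v y y') ! n < ?l v ! n"
    using n(1) ne y(2) lookup_component(1)[OF p, of y] by (simp add: lookup_exchange flip: y_def)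
  ultimately have "(?l (exchange v y y'), ?l v) \<in> lexord {(u, v). u < v}"
    using n(1) by (auto simp: lexord_take_index_conv)
  then have "key j xs (exchange v y y') < key j xs v"
    by (simp add: key_def def_eq list_less_def)
  with y ne comp show thesis using that by blast
qed

text \<open>Exponents in the component are at most \<open>j\<close>, so the truncated differences in
  the key determine them.\<close>

lemma inj_key:
  assumes "v \<in> component j" "p \<in> component j" "set xs = X" "key j xs p = key j xs v"
  shows "p = v"
proof (rule poly_mapping_eqI)
  fix x
  note lookup_component[OF assms(1), of x] lookup_component[OF assms(2), of x]
  moreover have "j - Poly_Mapping.lookup p x = j - Poly_Mapping.lookup v x" if "x \<in> X"
    using assms(3,4) that by (auto simp: key_def)
  ultimately show "Poly_Mapping.lookup p x = Poly_Mapping.lookup v x"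
    by (metis diff_diff_cancel)
qed

lemma component_mono_lin_quot: "\<exists>us. mono_lin_quot X us \<and> set us = component j"
proof -
  obtain xs where xs: "set xs = X" "distinct xs"
    using finite_distinct_list[OF fin] by blast
  obtain us where us: "distinct us" "set us = component j"
    and sorted: "\<And>i k. i < k \<Longrightarrow> k < length us \<Longrightarrow> key j xs (us ! i) \<le> key j xs (us ! k)"
    using exists_list_sorted_by_key[OF finite_component[of j], of "key j xs"] by blast
  have "mono_lin_quot X us"
    unfolding mono_lin_quot_def
  proof (intro conjI ballI allI impI)
    fix u assume "u \<in> set us"
    then show "Poly_Mapping.keys u \<subseteq> X" using us(2) by (simp add: component_iff)
  next
    fix i assume i: "i < length us"
    define v where "v = us ! i"
    have v: "v \<in> component j" using nth_mem[OF i] us(2) by (simp add: v_def)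
    \<comment> \<open>As large as the divisibility clause permits. It remains to find, for each
      earlier \<open>p\<close>, a variable of \<open>Y\<close> in which \<open>p\<close> exceeds
      \<open>v\<close>.\<close>
    define Y where "Y = {y \<in> X. \<exists>k<i. divides_exp (us ! k) (v + Poly_Mapping.single y 1)}"
    have Y: "y \<in> Y" if h: "y \<in> X" "y \<noteq> y'" "exchange v y y' \<in> component j" "key j xs (exchange v y y') < key j xs v" for y y'
    proof -
      obtain k where k: "k < length us" "us ! k = exchange v y y'"
        using h(3) us(2) by (metis in_set_conv_nth)
      then have "\<not> i \<le> k"
        using sorted[of i k] h(4) by (cases "i = k") (auto simp: v_def)
      moreover have "divides_exp (us ! k) (v + Poly_Mapping.single y 1)"
        unfolding k(2) by (rule divides_exchange[OF h(2)])
      ultimately show ?thesis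
        unfolding Y_def using h(1) by (intro CollectI conjI exI[of _ k]) simp_all
    qed
    have "\<exists>y\<in>Y. Poly_Mapping.lookup v y < Poly_Mapping.lookup (us ! k) y" if k: "k < i" for k
    proof -
      define p where "p = us ! k"
      have p: "p \<in> component j" using nth_mem[of k us] k i us(2) by (simp add: p_def)
      have "key j xs p \<le> key j xs v" using sorted[OF k i] by (simp add: p_def v_def)
      moreover have "p \<noteq> v" using k i us(1) by (simp add: p_def v_def nth_eq_iff_index_eq)
      ultimately have less: "key j xs p < key j xs v"
        using inj_key[OF v p xs(1)] by (metis order.order_iff_strict)
      show ?thesis
      proof (cases "\<exists>x\<in>B. deficit p x < deficit v x")
        case True
        then obtain x where x: "x \<in> B" "deficit p x < deficit v x" by blast
        then have "0 < deficit v x" by simp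
        from exchange_smaller_deficit[OF v x(1) this, of xs] obtain z
          where z: "z \<noteq> x" "exchange v x z \<in> component j" "key j xs (exchange v x z) < key j xs v" .
        have "x \<in> Y"
          using x(1) B by (intro Y[OF _ z(1)[symmetric] z(2,3)]) auto
        moreover have "Poly_Mapping.lookup v x < Poly_Mapping.lookup p x"
          using x by (auto simp: deficit_def)
        ultimately show ?thesis by (auto simp: p_def)
      next
        \<comment> \<open>Here \<open>deficit p\<close> is nowhere below \<open>deficit v\<close>,
          while the first entry of the key bounds its sum from above. The deficits therefore agree
          and the lexicographic part decides.\<close>
        case False
        moreover have "(\<Sum>x\<in>B. deficit p x) \<le> (\<Sum>x\<in>B. deficit v x)"
          using less by (auto simp: key_def)
        ultimately have "deficit v x = deficit p x" if "x \<in> B" for x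
          using that by (intro eq_of_le_sum) (auto simp: not_less)
        then have "deficit p = deficit v"
          by (auto simp: fun_eq_iff deficit_def)
        from exchange_same_deficit[OF v p this xs less] obtain y y' where
          y: "y \<in> X" "Poly_Mapping.lookup v y < Poly_Mapping.lookup p y" "y \<noteq> y'"
          "exchange v y y' \<in> component j" "key j xs (exchange v y y') < key j xs v" .
        have "y \<in> Y" by (rule Y[OF y(1,3-5)])
        with y(2) show ?thesis by (auto simp: p_def)
      qed
    qed
    moreover have "Y \<subseteq> X" "\<forall>y\<in>Y. \<exists>k<i. divides_exp (us ! k) (v + Poly_Mapping.single y 1)"
      by (auto simp: Y_def)
    ultimately show "\<exists>Y\<subseteq>X. (\<forall>k<i. \<exists>y\<in>Y. Poly_Mapping.lookup (us ! i) y < Poly_Mapping.lookup (us ! k) y) \<and>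
        (\<forall>y\<in>Y. \<exists>k<i. divides_exp (us ! k) (us ! i + Poly_Mapping.single y 1))"
      unfolding v_def by (intro exI[of _ Y]) simp
  qed
  with us(2) show ?thesis by blast
qed

lemma componentwise_linear_w:
  "componentwise_linear X (Idl\<^bsub>poly_ring X\<^esub> (mono ` w ` M :: ('x, 'k::field) mpoly set))"
proof (rule componentwise_linear_mono[OF fin])
  show "Poly_Mapping.keys u \<subseteq> X" if "u \<in> w ` M" for u
    using that keys_w by blast
  show "\<exists>us. mono_lin_quot X us \<and> set us = {v. Poly_Mapping.keys v \<subseteq> X \<and> mdeg v = j \<and> (\<exists>u\<in>w ` M. divides_exp u v)}" for j
    using component_mono_lin_quot[of j] by (simp add: component_def)
qed

end


section \<open>Cover ideals of clique multi-whiskered graphs\<close>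

definition independent_set :: "'v sgraph \<Rightarrow> 'v set \<Rightarrow> bool" where
  "independent_set G A \<longleftrightarrow> A \<subseteq> verts G \<and> (\<forall>e\<in>edges G. \<not> e \<subseteq> A)"

definition whisker_cover ::
    "'v sgraph \<Rightarrow> nat \<Rightarrow> (nat \<Rightarrow> 'v set) \<Rightarrow> (nat \<Rightarrow> nat) \<Rightarrow> 'v set \<Rightarrow> 'v wvertex set" where
  "whisker_cover G m P r A = Base ` (verts G - A) \<union>
     {Whisker i k | i k. i \<in> {1..m} \<and> k \<in> {1..r i} \<and> A \<inter> P i \<noteq> {}}"

lemma independent_set_subset: "independent_set G A \<Longrightarrow> A' \<subseteq> A \<Longrightarrow> independent_set G A'"
  unfolding independent_set_def by blast

lemma verts_multi_whiskered:
  "verts (multi_whiskered G m P r) =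
    Base ` verts G \<union> {Whisker i k | i k. i \<in> {1..m} \<and> k \<in> {1..r i}}"
  by (auto simp: multi_whiskered_def)

lemma vertex_cover_multi_whiskered:
  "vertex_cover (multi_whiskered G m P r) C \<longleftrightarrow>
    C \<subseteq> verts (multi_whiskered G m P r) \<and> (\<forall>e\<in>edges G. \<exists>x\<in>e. Base x \<in> C) \<and>
    (\<forall>i\<in>{1..m}. \<forall>x\<in>P i. \<forall>k\<in>{1..r i}. Base x \<in> C \<or> Whisker i k \<in> C)"
proof -
  have "(\<forall>e\<in>edges (multi_whiskered G m P r). Q e) \<longleftrightarrow> (\<forall>e\<in>edges G. Q (Base ` e)) \<and>
      (\<forall>i\<in>{1..m}. \<forall>x\<in>P i. \<forall>k\<in>{1..r i}. Q {Base x, Whisker i k})" for Q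
  proof -
    have "edges (multi_whiskered G m P r) = (\<lambda>e. Base ` e) ` edges G \<union>
        (\<Union>i\<in>{1..m}. \<Union>x\<in>P i. (\<lambda>k. {Base x, Whisker i k}) ` {1..r i})"
      by (simp only: multi_whiskered_def sgraph.simps Setcompr_eq_image Collect_mem_eq)
    then show ?thesis by (simp only: ball_Un ball_UN ball_simps)
  qed
  moreover have "C \<inter> e \<noteq> {} \<longleftrightarrow> (\<exists>x\<in>e. x \<in> C)" for e
    by blast
  ultimately show ?thesis
    by (simp add: vertex_cover_def)
qed

locale clique_whiskering =
  fixes G :: "'v sgraph" and m :: nat and P :: "nat \<Rightarrow> 'v set" and r :: "nat \<Rightarrow> nat"
  assumes G: "simple_graph G" and cp: "clique_partition G m P" and r: "\<forall>i\<in>{1..m}. 1 \<le> r i"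
begin

abbreviation "H \<equiv> multi_whiskered G m P r"
abbreviation "cov \<equiv> whisker_cover G m P r"

lemma finite_verts: "finite (verts G)"
  using G by (simp add: simple_graph_def)

lemma edge_subset: "e \<in> edges G \<Longrightarrow> e \<subseteq> verts G"
  using G by (simp add: simple_graph_def)

lemma P_subset: "i \<in> {1..m} \<Longrightarrow> P i \<subseteq> verts G"
  using cp by (auto simp: clique_partition_def)

lemma verts_P: "x \<in> verts G \<Longrightarrow> \<exists>i\<in>{1..m}. x \<in> P i"
  using cp by (auto simp: clique_partition_def)

lemma P_clique: "i \<in> {1..m} \<Longrightarrow> x \<in> P i \<Longrightarrow> y \<in> P i \<Longrightarrow> x \<noteq> y \<Longrightarrow> {x, y} \<in> edges G"
  using cp by (auto simp: clique_partition_def complete_graph_def induced_subgraph_def)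

lemma finite_verts_H: "finite (verts H)"
proof -
  have "verts H = Base ` verts G \<union> (\<Union>i\<in>{1..m}. Whisker i ` {1..r i})"
    by (auto simp: verts_multi_whiskered)
  then show ?thesis using finite_verts by simp
qed

lemma independent_clique:
  "independent_set G A \<Longrightarrow> i \<in> {1..m} \<Longrightarrow> x \<in> A \<inter> P i \<Longrightarrow> y \<in> A \<inter> P i \<Longrightarrow> x = y"
  using P_clique[of i x y] unfolding independent_set_def
  by (metis Int_iff empty_subsetI insert_subset)

lemma vertex_cover_cov:
  assumes "independent_set G A"
  shows "vertex_cover H (cov A)"
  unfolding vertex_cover_multi_whiskered
proof (intro conjI ballI)
  show "cov A \<subseteq> verts H"
    by (auto simp: whisker_cover_def verts_multi_whiskered)
  show "\<exists>x\<in>e. Base x \<in> cov A" if e: "e \<in> edges G" for e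
  proof -
    obtain x where "x \<in> e" "x \<notin> A" using assms e by (auto simp: independent_set_def)
    then show ?thesis using edge_subset[OF e] by (auto simp: whisker_cover_def)
  qed
  show "Base x \<in> cov A \<or> Whisker i k \<in> cov A" if "i \<in> {1..m}" "x \<in> P i" "k \<in> {1..r i}" for i x k
    using that P_subset[OF that(1)] by (auto simp: whisker_cover_def)
qed

lemma minimal_vertex_cover_iff:
  "minimal_vertex_cover H C \<longleftrightarrow> (\<exists>A. independent_set G A \<and> C = cov A)"
proof
  assume min: "minimal_vertex_cover H C"
  then have C: "vertex_cover H C" by (simp add: minimal_vertex_cover_def)
  define A where "A = {x \<in> verts G. Base x \<notin> C}"
  have A: "independent_set G A"
    using C unfolding vertex_cover_multi_whiskered independent_set_def A_def by blast
  have "cov A \<subseteq> C"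
    using C unfolding vertex_cover_multi_whiskered whisker_cover_def A_def by blast
  then have "C = cov A"
    using min vertex_cover_cov[OF A] unfolding minimal_vertex_cover_def by blast
  with A show "\<exists>A. independent_set G A \<and> C = cov A" by blast
next
  assume "\<exists>A. independent_set G A \<and> C = cov A"
  then obtain A where A: "independent_set G A" and C: "C = cov A" by blast
  have Base_cov: "Base x \<in> cov A \<longleftrightarrow> x \<in> verts G \<and> x \<notin> A" for x
    by (auto simp: whisker_cover_def)
  have "cov A \<subseteq> D" if D: "vertex_cover H D" "D \<subseteq> cov A" for D
  proof
    fix c assume c: "c \<in> cov A"
    have edge: "\<exists>x\<in>e. Base x \<in> D" if "e \<in> edges G" for e
      using D(1) that by (simp add: vertex_cover_multi_whiskered)
    have whisk: "Base x \<in> D \<or> Whisker i k \<in> D" if "i \<in> {1..m}" "x \<in> P i" "k \<in> {1..r i}" for i x k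
      using D(1) that unfolding vertex_cover_multi_whiskered by blast
    show "c \<in> D"
    proof (cases c)
      case (Base x)
      with c have x: "x \<in> verts G" "x \<notin> A" by (auto simp: Base_cov)
      then obtain i where i: "i \<in> {1..m}" "x \<in> P i" using verts_P by blast
      show ?thesis
      proof (cases "A \<inter> P i = {}")
        case True
        \<comment> \<open>Since \<open>r i\<close> is positive this whisker exists, and its edge to
          \<open>x\<close> then forces \<open>Base x\<close> into \<open>D\<close>.\<close>
        then have "Whisker i 1 \<notin> D" using D(2) by (auto simp: whisker_cover_def)
        moreover have "1 \<in> {1..r i}" using r i(1) by simp
        ultimately show ?thesis using whisk[OF i] Base by blast
      next
        case False
        then obtain y where y: "y \<in> A" "y \<in> P i" by blast
        then have "{x, y} \<in> edges G" using P_clique[OF i] x(2) by blast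
        moreover have "Base y \<notin> D" using y(1) D(2) Base_cov by blast
        ultimately show ?thesis using edge Base by blast
      qed
    next
      case (Whisker i k)
      with c obtain y where y: "i \<in> {1..m}" "k \<in> {1..r i}" "y \<in> A" "y \<in> P i"
        by (auto simp: whisker_cover_def)
      then have "Base y \<notin> D" using D(2) Base_cov by blast
      then show ?thesis using whisk[OF y(1,4,2)] Whisker by blast
    qed
  qed
  then show "minimal_vertex_cover H C"
    unfolding minimal_vertex_cover_def C using vertex_cover_cov[OF A] by blast
qed

section \<open>Sums of indicator functions and powers of the cover ideal\<close>

fun nbrs :: "'v wvertex \<Rightarrow> 'v wvertex set" where
  "nbrs (Base x) = {}"
| "nbrs (Whisker i k) = Base ` P i"

definition base_indicator :: "'v set \<Rightarrow> 'v wvertex \<Rightarrow> nat" where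
  "base_indicator A x = of_bool (x \<in> Base ` A)"

primrec indep_sums :: "nat \<Rightarrow> ('v wvertex \<Rightarrow> nat) set" where
  "indep_sums 0 = {\<lambda>_. 0}"
| "indep_sums (Suc n) =
    {\<lambda>x. a x + base_indicator A x | a A. a \<in> indep_sums n \<and> independent_set G A}"

text \<open>The exponent of a product of \<open>n\<close> cover monomials whose independent sets
  have indicator sum \<open>a\<close>: a base vertex \<open>x\<close> is missing from exactly
  \<open>a x\<close> of the covers.\<close>

definition cover_exp :: "nat \<Rightarrow> ('v wvertex \<Rightarrow> nat) \<Rightarrow> 'v wvertex \<Rightarrow>\<^sub>0 nat" where
  "cover_exp n a = Abs_poly_mapping (\<lambda>x. if x \<in> Base ` verts G then n - a x
     else if x \<in> verts H then \<Sum>y\<in>nbrs x. a y else 0)"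

lemma lookup_cover_exp:
  "Poly_Mapping.lookup (cover_exp n a) x = (if x \<in> Base ` verts G then n - a x
     else if x \<in> verts H then \<Sum>y\<in>nbrs x. a y else 0)"
proof -
  have "finite {x. (if x \<in> Base ` verts G then n - a x else if x \<in> verts H then \<Sum>y\<in>nbrs x. a y else 0) \<noteq> 0}"
    by (rule finite_subset[OF _ finite_verts_H]) (auto simp: verts_multi_whiskered)
  then show ?thesis by (simp add: cover_exp_def)
qed

lemma indep_sums_supp: "a \<in> indep_sums n \<Longrightarrow> x \<notin> Base ` verts G \<Longrightarrow> a x = 0"
proof (induction n arbitrary: a)
  case (Suc n)
  then obtain b A where "b \<in> indep_sums n" "A \<subseteq> verts G" "a = (\<lambda>x. b x + base_indicator A x)"
    by (auto simp: independent_set_def)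
  then show ?case using Suc.IH[of b] Suc.prems(2) by (auto simp: base_indicator_def)
qed simp

lemma indep_sums_le: "a \<in> indep_sums n \<Longrightarrow> a x \<le> n"
proof (induction n arbitrary: a)
  case (Suc n)
  then obtain b A where "b \<in> indep_sums n" "a = (\<lambda>x. b x + base_indicator A x)" by auto
  then show ?case using Suc.IH[of b] by (simp add: base_indicator_def)
qed simp

text \<open>One independent set is split off at a time. \<open>A'\<close> consists of the vertices
  of \<open>A\<close> where \<open>a'\<close> is too small for \<open>b\<close>; there
  \<open>b\<close> equals \<open>a' + 1\<close>, so the remainder is bounded by \<open>a'\<close>.
  Subsets of independent sets, including the empty one, are independent.\<close>

lemma indep_sums_down: "a \<in> indep_sums n \<Longrightarrow> (\<And>x. b x \<le> a x) \<Longrightarrow> b \<in> indep_sums n"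
proof (induction n arbitrary: a b)
  case (Suc n)
  then obtain a' A where a': "a' \<in> indep_sums n" and A: "independent_set G A"
    and a: "a = (\<lambda>x. a' x + base_indicator A x)" by auto
  define A' where "A' = {x \<in> A. a' (Base x) < b (Base x)}"
  define b' where "b' x = b x - base_indicator A' x" for x
  have "b' x \<le> a' x" for x
  proof (cases "x \<in> Base ` A \<and> b x \<le> a' x")
    case False
    show ?thesis
    proof (cases "x \<in> Base ` A")
      case True
      then have "x \<in> Base ` A'" using False by (auto simp: A'_def)
      then show ?thesis using Suc.prems(2)[of x] True by (simp add: b'_def a base_indicator_def)
    next
      case False
      then show ?thesis using Suc.prems(2)[of x] by (simp add: b'_def a base_indicator_def)
    qed
  qed (auto simp: b'_def intro: le_trans[OF diff_le_self])
  then have "b' \<in> indep_sums n" using Suc.IH[OF a'] by blast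
  moreover have "independent_set G A'"
    using A by (rule independent_set_subset) (auto simp: A'_def)
  moreover have "b = (\<lambda>x. b' x + base_indicator A' x)"
    by (auto simp: b'_def A'_def fun_eq_iff base_indicator_def)
  ultimately show ?case by auto
qed auto

lemma whisker_monomials:
  "whisker_monomials (verts H) (Base ` verts G) nbrs (indep_sums n) n (cover_exp n)"
proof
  show "\<exists>z\<in>verts H - Base ` verts G. x \<in> nbrs z" if x: "x \<in> Base ` verts G" for x
  proof -
    obtain v i where "x = Base v" "i \<in> {1..m}" "v \<in> P i" using x verts_P by blast
    then show ?thesis
      using r by (intro bexI[of _ "Whisker i 1"]) (auto simp: verts_multi_whiskered)
  qed
  show "nbrs z \<subseteq> Base ` verts G" if z: "z \<in> verts H - Base ` verts G" for z
  proof -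
    obtain i k where "z = Whisker i k" "i \<in> {1..m}" using z by (auto simp: verts_multi_whiskered)
    then show ?thesis using P_subset[of i] by (simp add: image_mono)
  qed
qed (use finite_verts_H indep_sums_supp indep_sums_le indep_sums_down lookup_cover_exp
      in \<open>auto simp: verts_multi_whiskered\<close>)

lemma cover_monomial:
  assumes "independent_set G A"
  shows "(\<Prod>c\<in>cov A. var c) = (mono (cover_exp 1 (base_indicator A)) :: ('v wvertex, 'k::field) mpoly)"
proof -
  have sub: "cov A \<subseteq> verts H"
    using vertex_cover_cov[OF assms] by (simp add: vertex_cover_def)
  then have fin: "finite (cov A)"
    using finite_verts_H finite_subset by blast
  have "(\<Sum>c\<in>cov A. Poly_Mapping.single c 1) = cover_exp 1 (base_indicator A)"
  proof (rule poly_mapping_eqI)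
    fix x
    have "Poly_Mapping.lookup (\<Sum>c\<in>cov A. Poly_Mapping.single c 1) x = of_bool (x \<in> cov A)"
      using fin by (simp add: lookup_sum lookup_single when_def)
    also have "\<dots> = Poly_Mapping.lookup (cover_exp 1 (base_indicator A)) x"
    proof (cases "x \<in> verts H - Base ` verts G")
      case True
      then obtain i k where x: "x = Whisker i k" "i \<in> {1..m}" "k \<in> {1..r i}"
        by (auto simp: verts_multi_whiskered)
      have "finite (P i)" using finite_subset[OF P_subset[OF x(2)] finite_verts] .
      have "(\<Sum>y\<in>Base ` P i. of_bool (y \<in> Base ` A)) = (\<Sum>y\<in>P i. of_bool (y \<in> A) :: nat)"
        by (subst sum.reindex) (auto simp: inj_on_def intro!: sum.cong)
      also have "\<dots> = card (A \<inter> P i)"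
        using \<open>finite (P i)\<close> by (simp add: sum.If_cases of_bool_def Int_def conj_commute)
      \<comment> \<open>The clique condition turns membership of the whisker in the cover into a
        sum: at most one vertex of \<open>A\<close> lies in \<open>P i\<close>.\<close>
      also have "\<dots> = of_bool (A \<inter> P i \<noteq> {})"
      proof (cases "A \<inter> P i = {}")
        case False
        then obtain y where "A \<inter> P i = {y}" using independent_clique[OF assms x(2)] by blast
        then show ?thesis by simp
      qed simp
      finally show ?thesis
        using x True by (auto simp: lookup_cover_exp whisker_cover_def base_indicator_def)
    qed (use sub in \<open>auto simp: lookup_cover_exp whisker_cover_def verts_multi_whiskered base_indicator_def\<close>)
    finally show "Poly_Mapping.lookup (\<Sum>c\<in>cov A. Poly_Mapping.single c 1) x
      = Poly_Mapping.lookup (cover_exp 1 (base_indicator A)) x" .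
  qed
  then show ?thesis by (simp only: prod_var[OF fin])
qed

lemma indep_sums_1: "indep_sums 1 = base_indicator ` Collect (independent_set G)"
  by (auto simp: One_nat_def)

lemma cover_ideal_eq:
  "cover_ideal H = Idl\<^bsub>poly_ring (verts H)\<^esub> (mono ` cover_exp 1 ` indep_sums 1 :: ('v wvertex, 'k::field) mpoly set)"
proof -
  have "{\<Prod>c\<in>C. var c | C. minimal_vertex_cover H C}
      = {\<Prod>c\<in>cov A. var c :: ('v wvertex, 'k) mpoly | A. independent_set G A}"
    unfolding minimal_vertex_cover_iff by blast
  also have "\<dots> = (\<lambda>A. \<Prod>c\<in>cov A. var c) ` Collect (independent_set G)"
    by blast
  also have "\<dots> = mono ` cover_exp 1 ` indep_sums 1"
    unfolding indep_sums_1 image_image by (rule image_cong) (simp_all only: mem_Collect_eq cover_monomial)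
  finally show ?thesis by (simp add: cover_ideal_def)
qed

text \<open>Truncated subtraction is additive here because \<open>a\<close> is bounded by
  \<open>n\<close> and \<open>b\<close> by 1: \<open>Suc n - (a x + b x)\<close> splits into
  \<open>n - a x\<close> and \<open>1 - b x\<close>.\<close>

lemma cover_exp_Suc:
  "cover_exp (Suc n) ` indep_sums (Suc n)
    = {u + v | u v. u \<in> cover_exp n ` indep_sums n \<and> v \<in> cover_exp 1 ` indep_sums 1}"
proof -
  have "cover_exp (Suc n) (\<lambda>x. a x + b x) = cover_exp n a + cover_exp 1 b"
    if "a \<in> indep_sums n" "b \<in> indep_sums 1" for a b
    using indep_sums_le[OF that(1)] indep_sums_le[OF that(2)]
    by (intro poly_mapping_eqI) (simp add: lookup_cover_exp lookup_add sum.distrib)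
  moreover have "indep_sums (Suc n) = {\<lambda>x. a x + b x | a b. a \<in> indep_sums n \<and> b \<in> indep_sums 1}"
    unfolding indep_sums_1 by auto
  ultimately show ?thesis by (fastforce simp: image_iff)
qed

lemma cover_ideal_power:
  "cover_ideal H [^]\<^bsub>ideals_set (poly_ring (verts H))\<^esub> (n::nat)
    = Idl\<^bsub>poly_ring (verts H)\<^esub> (mono ` cover_exp n ` indep_sums n :: ('v wvertex, 'k::field) mpoly set)"
proof (induction n)
  case 0
  interpret cring "poly_ring (verts H) :: ('v wvertex, 'k) mpoly ring" by (rule cring_poly_ring)
  \<comment> \<open>The zeroth power is the unit of \<open>ideals_set\<close>, the whole ring,
    generated by the monomial with exponent 0.\<close>
  have "cover_exp 0 (\<lambda>_. 0) = 0"
    by (rule poly_mapping_eqI) (simp add: lookup_cover_exp)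
  then have "mono ` cover_exp 0 ` indep_sums 0 = {\<one>\<^bsub>poly_ring (verts H) :: ('v wvertex, 'k) mpoly ring\<^esub>}"
    by (simp add: mono_def)
  then show ?case
    using genideal_one by (simp add: nat_pow_def ideals_set_def)
next
  case (Suc n)
  have keys: "Poly_Mapping.keys u \<subseteq> verts H" if "u \<in> cover_exp k ` indep_sums k" for u k
    using that whisker_monomials.keys_w[OF whisker_monomials] by blast
  have "cover_ideal H [^]\<^bsub>ideals_set (poly_ring (verts H))\<^esub> Suc n
      = ideal_prod (poly_ring (verts H))
        (cover_ideal H [^]\<^bsub>ideals_set (poly_ring (verts H))\<^esub> n) (cover_ideal H :: ('v wvertex, 'k) mpoly set)"
    by (simp add: nat_pow_def ideals_set_def)
  also have "\<dots> = Idl\<^bsub>poly_ring (verts H)\<^esub> (mono ` cover_exp (Suc n) ` indep_sums (Suc n))"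
    unfolding Suc.IH unfolding cover_ideal_eq cover_exp_Suc
    by (rule ideal_prod_mono) (rule keys, assumption)+
  finally show ?case .
qed

end

theorem theorem3p3:
  fixes G :: "'v sgraph" and m :: nat and P :: "nat \<Rightarrow> 'v set" and r :: "nat \<Rightarrow> nat"
    and H :: "'v wvertex sgraph" and I :: "('v wvertex, 'k::field) mpoly set" and t :: nat
  assumes "simple_graph G"
    and "clique_partition G m P"
    and "\<forall>i\<in>{1..m}. 1 \<le> r i"
    and "H = multi_whiskered G m P r"
    and "I = cover_ideal H"
    and "1 \<le> t"
  shows "linear_quotients (verts H) (I [^]\<^bsub>ideals_set (poly_ring (verts H))\<^esub> t) \<and>
         componentwise_linear (verts H) (I [^]\<^bsub>ideals_set (poly_ring (verts H))\<^esub> t)"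
proof -
  interpret clique_whiskering G m P r
    using assms(1-3) by unfold_locales
  interpret whisker_monomials "verts (multi_whiskered G m P r)" "Base ` verts G" nbrs
      "indep_sums t" t "cover_exp t"
    by (rule whisker_monomials)
  show ?thesis
    unfolding assms(4,5) cover_ideal_power using linear_quotients_w componentwise_linear_w by blast
qed

end
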